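(* Let $n\ge1$ be an integer and $1\le p<\infty$. The space $\mathcal D_p^F(\mathbb R^{2n},\Delta_n)$ of persistence diagrams with finitely (but arbitrarily) many points has infinite covering, Hausdorff, asymptotic, Assouad, and Assouad--Nagata dimension.
   Context: $\mathbb R^{2n}$ carries the Euclidean metric $d$ and $\Delta_n=\{(v,v)\in\mathbb R^{2n}:v\in\mathbb R^n\}$. For a metric space $(X,d)$ and a non-empty closed subset $A$, $\mathcal D_p^F(X,A)$ is defined as follows. Consider finite multisets of elements of $X$; the sum of two multisets is their disjoint union. Two finite multisets $\widetilde\sigma,\widetilde\tau$ are equivalent if $\widetilde\sigma+\widetilde\alpha=\widetilde\tau+\widetilde\beta$ for some finite multisets $\widetilde\alpha,\widetilde\beta$ of elements of $A$ (i.e. they have the same points outside $A$ with the same multiplicities). $\mathcal D_p^F(X,A)$ is the set of equivalence classes, equipped with the $p$-Wasserstein metric $d_p(\sigma,\tau)=\inf\big(\sum_{x\in\widetilde\sigma+\widetilde\alpha}d(x,\phi(x))^p\big)^{1/p}$, the infimum being over all countable multisets $\widetilde\alpha,\widetilde\beta$ of elements of $A$ and all bijections $\phi\colon\widetilde\sigma+\widetilde\alpha\to\widetilde\tau+\widetilde\beta$ of multisets. Dimensions of a metric space $M$. Covering dimension: the least $m$ such that every finite open cover of $M$ has an open refinement in which each point belongs to at most $m+1$ members ($\infty$ if none). Hausdorff dimension: the usual one. Asymptotic dimension: the least $m$ such that for every $R>0$ there is a cover of $M$ by sets of uniformly bounded diameter such that every ball of radius $R$ meets at most $m+1$ members ($\infty$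 if none). Assouad dimension: the infimum of $s\ge0$ for which there is $C>0$ such that for all $0<r<R$ every ball of radius $R$ can be covered by at most $C(R/r)^s$ balls of radius $r$ ($\infty$ if none). Assouad--Nagata dimension: the least $m$ for which there is $c>0$ such that for every $r>0$ there is a cover of $M$ by sets of diameter at most $cr$ such that every subset of $M$ of diameter at most $r$ meets at most $m+1$ members ($\infty$ if none). *)

theory Defs
  imports "HOL-Analysis.Analysis" "HOL-Library.Multiset" "HOL-Library.Extended_Nat"
begin

section \<open>Spaces of finite persistence diagrams\<close>

text \<open>
  The Wasserstein metric involves countably infinite multisets, which \<open>HOL-Library\<close> does not
  provide. They are represented by multiplicity functions into \<open>enat\<close> with countable support.
  A multiset with multiplicities \<open>m\<close> has as its elements the labelled copies \<open>(x, k)\<close>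
  with \<open>k < m x\<close>, so that a bijection of multisets is a bijection between sets of copies.
\<close>

definition countable_multiset_in :: "'a set \<Rightarrow> ('a \<Rightarrow> enat) \<Rightarrow> bool" where
  "countable_multiset_in A \<alpha> \<longleftrightarrow> countable {x. \<alpha> x \<noteq> 0} \<and> {x. \<alpha> x \<noteq> 0} \<subseteq> A"

definition copies :: "('a \<Rightarrow> enat) \<Rightarrow> ('a \<times> nat) set" where
  "copies m = {(x, k). enat k < m x}"

definition plus_countable :: "'a multiset \<Rightarrow> ('a \<Rightarrow> enat) \<Rightarrow> 'a \<Rightarrow> enat" where
  "plus_countable \<sigma> \<alpha> = (\<lambda>x. enat (count \<sigma> x) + \<alpha> x)"

definition matching_cost ::
    "real \<Rightarrow> ('a::metric_space \<times> nat) set \<Rightarrow> ('a \<times> nat \<Rightarrow> 'a \<times> nat) \<Rightarrow> ennreal" where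
  "matching_cost p E \<phi> = (\<Sum>\<^sub>\<infinity>e\<in>E. ennreal (dist (fst e) (fst (\<phi> e)) powr p))"

text \<open>
  For \<open>A\<close> nonempty the infimum is finite, because all points of \<open>\<sigma>\<close> and \<open>\<tau>\<close> may be matched to
  points of \<open>A\<close>; hence \<open>enn2real\<close> loses nothing.
\<close>

definition wasserstein ::
    "real \<Rightarrow> 'a::metric_space set \<Rightarrow> 'a multiset \<Rightarrow> 'a multiset \<Rightarrow> real" where
  "wasserstein p A \<sigma> \<tau> =
     enn2real (Inf {matching_cost p (copies (plus_countable \<sigma> \<alpha>)) \<phi> | \<alpha> \<beta> \<phi>.
        countable_multiset_in A \<alpha> \<and> countable_multiset_in A \<beta> \<and>
        bij_betw \<phi> (copies (plus_countable \<sigma> \<alpha>)) (copies (plus_countable \<tau> \<beta>))})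
     powr (1 / p)"

definition diagram_equiv :: "'a set \<Rightarrow> ('a multiset \<times> 'a multiset) set" where
  "diagram_equiv A = {(\<sigma>, \<tau>). \<exists>\<alpha> \<beta>. set_mset \<alpha> \<subseteq> A \<and> set_mset \<beta> \<subseteq> A \<and> \<sigma> + \<alpha> = \<tau> + \<beta>}"

definition finite_diagrams :: "'a set \<Rightarrow> 'a multiset set set" where
  "finite_diagrams A = UNIV // diagram_equiv A"

text \<open>
  The choice of representatives is immaterial: a finite multiset in \<open>A\<close> added to one argument
  of \<open>wasserstein\<close> can be absorbed into \<open>\<alpha>\<close> and \<open>\<beta>\<close> and matched to itself.
\<close>

definition diagram_dist ::
    "real \<Rightarrow> 'a::metric_space set \<Rightarrow> 'a multiset set \<Rightarrow> 'a multiset set \<Rightarrow> real" where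
  "diagram_dist p A S T = wasserstein p A (SOME \<sigma>. \<sigma> \<in> S) (SOME \<tau>. \<tau> \<in> T)"

definition diagonal :: "('a \<times> 'a) set" where
  "diagonal = {(v, v) | v. True}"

section \<open>Dimensions\<close>

text \<open>
  For \<open>enat\<close> and \<open>ennreal\<close> the infimum of the empty set is \<open>\<infinity>\<close>, and a nonempty set of
  \<open>enat\<close> contains its infimum.
\<close>

definition covering_dimension :: "'b topology \<Rightarrow> enat" where
  "covering_dimension X = Inf {enat m | m.
     \<forall>\<U>. finite \<U> \<and> (\<forall>U\<in>\<U>. openin X U) \<and> \<Union>\<U> = topspace X \<longrightarrow>
       (\<exists>\<V>. (\<forall>V\<in>\<V>. openin X V) \<and> \<Union>\<V> = topspace X \<and> (\<forall>V\<in>\<V>. \<exists>U\<in>\<U>. V \<subseteq> U) \<and>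
            (\<forall>x\<in>topspace X. finite {V\<in>\<V>. x \<in> V} \<and> card {V\<in>\<V>. x \<in> V} \<le> m + 1))}"

context Metric_space
begin

definition diam :: "'a set \<Rightarrow> ennreal" where
  "diam S = (SUP x\<in>S. SUP y\<in>S. ennreal (d x y))"

definition hausdorff_premeasure :: "real \<Rightarrow> real \<Rightarrow> ennreal" where
  "hausdorff_premeasure s \<delta> = Inf {(\<Sum>i. ennreal (enn2real (diam (U i)) powr s)) | U :: nat \<Rightarrow> 'a set.
     (\<forall>i. U i \<subseteq> M \<and> diam (U i) \<le> ennreal \<delta>) \<and> (\<Union>i. U i) = M}"

definition hausdorff_measure :: "real \<Rightarrow> ennreal" where
  "hausdorff_measure s = (SUP \<delta>\<in>{0<..}. hausdorff_premeasure s \<delta>)"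

text \<open>
  The exponent \<open>s = 0\<close> is left out because \<open>0 powr 0 = 0\<close> would spoil the counting measure; this
  does not affect the infimum.
\<close>

definition hausdorff_dimension :: ennreal where
  "hausdorff_dimension = Inf {ennreal s | s. s > 0 \<and> hausdorff_measure s = 0}"

definition asymptotic_dimension :: enat where
  "asymptotic_dimension = Inf {enat m | m.
     \<forall>R>0. \<exists>\<U>. \<Union>\<U> = M \<and> (\<exists>D::real. \<forall>U\<in>\<U>. diam U \<le> ennreal D) \<and>
       (\<forall>x\<in>M. finite {U\<in>\<U>. U \<inter> mball x R \<noteq> {}} \<and> card {U\<in>\<U>. U \<inter> mball x R \<noteq> {}} \<le> m + 1)}"

definition assouad_dimension :: ennreal where
  "assouad_dimension = Inf {ennreal s | s. s \<ge> 0 \<and>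
     (\<exists>C>0. \<forall>r R. 0 < r \<and> r < R \<longrightarrow>
       (\<forall>x\<in>M. \<exists>F\<subseteq>M. finite F \<and> real (card F) \<le> C * (R / r) powr s \<and> mball x R \<subseteq> (\<Union>y\<in>F. mball y r)))}"

definition assouad_nagata_dimension :: enat where
  "assouad_nagata_dimension = Inf {enat m | m.
     \<exists>c>0. \<forall>r>0. \<exists>\<U>. \<Union>\<U> = M \<and> (\<forall>U\<in>\<U>. diam U \<le> ennreal (c * r)) \<and>
       (\<forall>S\<subseteq>M. diam S \<le> ennreal r \<longrightarrow>
          finite {U\<in>\<U>. U \<inter> S \<noteq> {}} \<and> card {U\<in>\<U>. U \<inter> S \<noteq> {}} \<le> m + 1)}"

end

end

theory Submission
  imports Defs
begin

text \<open>
  The space of finite diagrams contains cubes of every dimension and every size. Going out along a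
  ray away from the diagonal, there is room for \<open>N\<close> points, so far apart and so far from the
  diagonal that each of them can be moved independently over an interval of length \<open>L\<close>, and moving
  a point back is never longer than the way to another point or to the diagonal. This
  gives a map from \<open>[0, L]\<^sup>N\<close> into the space whose distances lie between the maximum metric and
  the \<open>\<ell>\<^sup>1\<close> metric of the cube (lemma \<open>Metric_space_with_cubes_finite_diagrams\<close>). These two bounds
  are all that the dimensions require, and the locale \<open>Metric_space_with_cubes\<close> isolates them.

  The covering, asymptotic and Assouad--Nagata dimensions are infinite by a discrete form of
  Lebesgue's covering theorem, \<open>grid_colouring_rainbow_cell\<close>: if a grid in \<open>[0, L]\<^sup>N\<close> is coloured
  by the members of a cover and no colour touches two opposite faces, then some cell of the grid
  meets \<open>N + 1\<close> colours. The conclusion is Kuhn's combinatorial lemma, the one behind Brouwer's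
  fixed point theorem. For the asymptotic and Assouad--Nagata dimensions the mesh is fixed and
  the cube is taken larger than all members of the cover; for the covering dimension the cube is
  fixed and the mesh is smaller than a Lebesgue number.

  The Hausdorff dimension is infinite because a set of diameter \<open>\<delta>\<close> meets the cube in
  a set of Lebesgue measure at most \<open>(2 \<delta>)\<^sup>N\<close>, so that for no positive \<open>s \<le> N\<close> does the \<open>s\<close>-dimensional
  measure vanish. The Assouad dimension is infinite because the \<open>N\<close> unit vectors are at distance at
  most \<open>1\<close> from the origin and pairwise at distance at least \<open>1\<close>: at one fixed pair of scales,
  arbitrarily many small balls are needed to cover one large ball.

  It also has to be shown that the Wasserstein distance is a metric. The countable multisets in its
  definition are removed first: pairs matched within the diagonal can be discarded, which leaves
  finite multisets of pairs, called couplings (lemma \<open>wasserstein_eq_Inf_coupling\<close>). Couplings can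
  be glued along their common marginal, and the triangle inequality follows from Minkowski's.
\<close>

section \<open>A rainbow cell in coloured grids\<close>

text \<open>
  Label a grid point in coordinate \<open>i\<close> by whether its colour reaches the face \<open>i = P\<close>. As no
  colour touches opposite faces, this is an admissible labelling for Kuhn's lemma, which yields a
  simplex on which the reduced label takes all \<open>n + 1\<close> values. The label of a point depends on its
  colour only, so the vertices of that simplex have \<open>n + 1\<close> colours.
\<close>
lemma grid_colouring_rainbow_cell:
  fixes c :: "(nat \<Rightarrow> nat) \<Rightarrow> 'c"
  assumes "0 < P"
    and faces: "\<And>x y i. (\<forall>j. x j \<le> P) \<Longrightarrow> (\<forall>j. y j \<le> P) \<Longrightarrow> i < n \<Longrightarrow> x i = 0 \<Longrightarrow> y i = P \<Longrightarrow> c x \<noteq> c y"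
  obtains q S where "card (c ` S) = n + 1"
    "\<forall>x\<in>S. \<forall>i. q i \<le> x i \<and> x i \<le> q i + 1 \<and> x i \<le> P"
proof -
  define lab where
    "lab x i = (if \<exists>y. (\<forall>j. y j \<le> P) \<and> c y = c x \<and> y i = P then 1 else 0 :: nat)" for x i
  let ?A = "{s. ksimplex P n s \<and> (reduced n \<circ> lab) ` s = {..n}}"
  have "odd (card ?A)"
  proof (rule kuhn_combinatorial[OF \<open>0 < P\<close>])
    show "\<forall>x j. (\<forall>j. x j \<le> P) \<and> j < n \<and> x j = 0 \<longrightarrow> lab x j = 0"
      unfolding lab_def using faces by (metis (full_types))
    show "\<forall>x j. (\<forall>j. x j \<le> P) \<and> j < n \<and> x j = P \<longrightarrow> lab x j = 1"
      unfolding lab_def by auto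
  qed
  then have "?A \<noteq> {}"
    by (rule odd_card_imp_not_empty)
  then obtain S b u where "kuhn_simplex P n b u S" and rl: "(reduced n \<circ> lab) ` S = {..n}"
    by (auto elim: ksimplex.cases)
  interpret kuhn_simplex P n b u S by fact
  have fin: "finite S" by (simp add: s_eq)
  have card_S: "card S = n + 1"
    by (simp add: card_image s_eq inj_enum)
  have lab_cong: "c x = c y \<Longrightarrow> lab x = lab y" for x y
    by (simp add: lab_def fun_eq_iff)
  define g where "g k = reduced n (lab (SOME x. c x = k))" for k
  have g: "g (c x) = reduced n (lab x)" for x
    unfolding g_def by (metis (mono_tags, lifting) lab_cong someI_ex)
  have "g ` c ` S = {..n}"
    using rl by (simp add: image_comp comp_def g)
  then have "n + 1 \<le> card (c ` S)"
    using fin card_image_le[of "c ` S" g] by simp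
  moreover have "card (c ` S) \<le> n + 1"
    using card_image_le[OF fin, of c] card_S by simp
  ultimately show ?thesis
    using that[of S b] base_le le_Suc_base s_le_p by simp
qed

section \<open>Metric spaces containing large cubes\<close>

lemma Inf_enat_eq_infinity:
  assumes "\<And>m. \<not> P m"
  shows "Inf {enat m | m. P m} = \<infinity>"
proof -
  have "{enat m | m. P m} = {}" using assms by blast
  then show ?thesis by (simp add: Inf_enat_def)
qed

lemma Inf_ennreal_eq_infinity:
  assumes "\<And>s. \<not> P s"
  shows "Inf {ennreal s | s. P s} = \<infinity>"
proof -
  have "{ennreal s | s. P s} = {}" using assms by blast
  then show ?thesis by simp
qed

text \<open>
  Points of cubes are functions on \<open>nat\<close> of which only the first \<open>N\<close> values matter, because the
  dimension \<open>N\<close> is chosen in the course of a proof and hence cannot be a type.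
\<close>
definition cube :: "nat \<Rightarrow> real \<Rightarrow> (nat \<Rightarrow> real) set" where
  "cube N L = {s. \<forall>i<N. 0 \<le> s i \<and> s i \<le> L}"

lemma PiE_subset_cube: "({..<N} \<rightarrow>\<^sub>E {0..L}) \<subseteq> cube N L"
proof
  fix s assume "s \<in> {..<N} \<rightarrow>\<^sub>E {0..L}"
  then have "s i \<in> {0..L}" if "i < N" for i
    using PiE_mem[of s "{..<N}" "\<lambda>_. {0..L}" i] that by blast
  then show "s \<in> cube N L"
    by (simp add: cube_def)
qed

context Metric_space
begin

lemma ennreal_dist_le_diam:
  assumes "x \<in> S" "y \<in> S"
  shows "ennreal (d x y) \<le> diam S"
  unfolding diam_def by (rule SUP_upper2[OF assms(1)], rule SUP_upper[OF assms(2)])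

lemma diam_le_iff: "diam S \<le> r \<longleftrightarrow> (\<forall>x\<in>S. \<forall>y\<in>S. ennreal (d x y) \<le> r)"
  by (auto simp: diam_def SUP_le_iff)

lemma dist_le_diam_bound:
  assumes "diam S \<le> ennreal D" "x \<in> S" "y \<in> S"
  shows "d x y \<le> max 0 D"
proof -
  have "ennreal (d x y) \<le> ennreal (max 0 D)"
    using ennreal_dist_le_diam[OF assms(2,3)] assms(1) by (metis ennreal_max_0 order_trans)
  then show ?thesis by simp
qed

lemma dist_le_enn2real_diam:
  assumes "diam S < \<infinity>" "x \<in> S" "y \<in> S"
  shows "d x y \<le> enn2real (diam S)"
  using enn2real_mono[OF ennreal_dist_le_diam[OF assms(2,3)]] assms(1) by simp

text \<open>
  The lower bound is the maximum metric and the upper bound the \<open>\<ell>\<^sup>1\<close> metric, so that every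
  \<open>\<ell>\<^sup>p\<close> metric fits in between.
\<close>
definition cube_embedding :: "nat \<Rightarrow> real \<Rightarrow> ((nat \<Rightarrow> real) \<Rightarrow> 'a) \<Rightarrow> bool" where
  "cube_embedding N L f \<longleftrightarrow> f ` cube N L \<subseteq> M \<and>
    (\<forall>s\<in>cube N L. \<forall>t\<in>cube N L.
       (\<forall>i<N. \<bar>s i - t i\<bar> \<le> d (f s) (f t)) \<and> d (f s) (f t) \<le> (\<Sum>i<N. \<bar>s i - t i\<bar>))"

lemma
  assumes "cube_embedding N L f" "s \<in> cube N L"
  shows cube_embedding_mem: "f s \<in> M"
    and cube_embedding_lower: "t \<in> cube N L \<Longrightarrow> i < N \<Longrightarrow> \<bar>s i - t i\<bar> \<le> d (f s) (f t)"
    and cube_embedding_upper: "t \<in> cube N L \<Longrightarrow> d (f s) (f t) \<le> (\<Sum>i<N. \<bar>s i - t i\<bar>)"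
  using assms unfolding cube_embedding_def by blast+

end

locale Metric_space_with_cubes = Metric_space +
  assumes cubes: "\<And>N L. 0 < L \<Longrightarrow> \<exists>f. cube_embedding N L f"
begin

text \<open>
  The common core of the asymptotic and the Assouad--Nagata case. In an integer grid of side longer
  than \<open>D\<close>, colour each point by a member of the cover that contains its image. Members of diameter
  at most \<open>D\<close> are too small to touch opposite faces, so some unit cell meets \<open>N + 1\<close> of them, and
  the image of a unit cell has diameter at most \<open>N\<close> whatever \<open>D\<close> is.
\<close>
lemma bounded_cover_multiplicity:
  assumes cover: "\<Union>\<U> = M" and bdd: "\<And>U. U \<in> \<U> \<Longrightarrow> diam U \<le> ennreal D"
  obtains \<V> S where "\<V> \<subseteq> \<U>" "card \<V> = N + 1" "S \<subseteq> M" "S \<noteq> {}"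
    "\<And>x y. x \<in> S \<Longrightarrow> y \<in> S \<Longrightarrow> d x y \<le> real N" "\<And>U. U \<in> \<V> \<Longrightarrow> U \<inter> S \<noteq> {}"
proof -
  obtain P :: nat where P: "max 0 D < real P"
    using reals_Archimedean2 by blast
  then have "0 < real P" by linarith
  obtain f where f: "cube_embedding N P f"
    using cubes[OF \<open>0 < real P\<close>] by blast
  note f_M = cube_embedding_mem[OF f]
    and lower = cube_embedding_lower[OF f]
    and upper = cube_embedding_upper[OF f]
  define g where "g x = f (\<lambda>i. real (x i))" for x :: "nat \<Rightarrow> nat"
  define c where "c x = (SOME U. U \<in> \<U> \<and> g x \<in> U)" for x
  have in_cube: "(\<lambda>i. real (x i)) \<in> cube N P" if "\<forall>j. x j \<le> P" for x
    using that by (simp add: cube_def)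
  have c: "c x \<in> \<U> \<and> g x \<in> c x" if "\<forall>j. x j \<le> P" for x
  proof -
    have "g x \<in> M" using f_M in_cube[OF that] by (simp add: g_def)
    then have "\<exists>U. U \<in> \<U> \<and> g x \<in> U" using cover by blast
    then show ?thesis unfolding c_def by (rule someI_ex)
  qed
  have faces: "c x \<noteq> c y"
    if *: "\<forall>j. x j \<le> P" "\<forall>j. y j \<le> P" "i < N" "x i = 0" "y i = P" for x y i
  proof
    assume "c x = c y"
    then have "d (g x) (g y) \<le> max 0 D"
      using c[OF *(1)] c[OF *(2)] dist_le_diam_bound[OF bdd, of "c x" "g x" "g y"] by simp
    moreover have "real P \<le> d (g x) (g y)"
      using lower[OF in_cube[OF *(1)] in_cube[OF *(2)] \<open>i < N\<close>] * by (simp add: g_def)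
    ultimately show False using P by linarith
  qed
  have "0 < P" using \<open>0 < real P\<close> by simp
  obtain q S where card_S: "card (c ` S) = N + 1"
    and cell: "\<forall>x\<in>S. \<forall>i. q i \<le> x i \<and> x i \<le> q i + 1 \<and> x i \<le> P"
    by (rule grid_colouring_rainbow_cell[of P N c, OF \<open>0 < P\<close> faces])
  have grid: "\<forall>j. x j \<le> P" if "x \<in> S" for x
    using cell that by blast
  show ?thesis
  proof (rule that[of "c ` S" "g ` S"])
    show "c ` S \<subseteq> \<U>" using c grid by blast
    show "card (c ` S) = N + 1" by (fact card_S)
    show "U \<inter> g ` S \<noteq> {}" if "U \<in> c ` S" for U using that c grid by blast
    show "g ` S \<subseteq> M" using f_M in_cube grid by (auto simp: g_def)
    show "g ` S \<noteq> {}" using card_S by auto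
    fix x y assume "x \<in> g ` S" "y \<in> g ` S"
    then obtain a b where ab: "a \<in> S" "b \<in> S" "x = g a" "y = g b" by blast
    have "d x y \<le> (\<Sum>i<N. \<bar>real (a i) - real (b i)\<bar>)"
      using upper[OF in_cube in_cube, OF grid grid, OF ab(1,2)] by (simp add: g_def ab)
    also have "\<dots> \<le> (\<Sum>i<N. 1)"
    proof (rule sum_mono)
      fix i
      have "q i \<le> a i \<and> a i \<le> q i + 1" "q i \<le> b i \<and> b i \<le> q i + 1"
        using cell ab by blast+
      then show "\<bar>real (a i) - real (b i)\<bar> \<le> 1" by linarith
    qed
    finally show "d x y \<le> real N" by simp
  qed
qed

theorem asymptotic_dimension_infinite: "asymptotic_dimension = \<infinity>"
  unfolding asymptotic_dimension_def
proof (rule Inf_enat_eq_infinity, rule notI)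
  fix m :: nat
  assume m: "\<forall>R>0. \<exists>\<U>. \<Union>\<U> = M \<and> (\<exists>D::real. \<forall>U\<in>\<U>. diam U \<le> ennreal D) \<and>
    (\<forall>x\<in>M. finite {U\<in>\<U>. U \<inter> mball x R \<noteq> {}} \<and> card {U\<in>\<U>. U \<inter> mball x R \<noteq> {}} \<le> m + 1)"
  show False
  proof -
    have "0 < real (m + 2)" by simp
    then obtain \<U> D where \<U>: "\<Union>\<U> = M" "\<And>U. U \<in> \<U> \<Longrightarrow> diam U \<le> ennreal D"
      and mult: "\<forall>x\<in>M. finite {U\<in>\<U>. U \<inter> mball x (m + 2) \<noteq> {}} \<and>
        card {U\<in>\<U>. U \<inter> mball x (m + 2) \<noteq> {}} \<le> m + 1"
      using m by meson
    obtain \<V> S where \<V>: "\<V> \<subseteq> \<U>" "card \<V> = (m + 1) + 1" "S \<subseteq> M" "S \<noteq> {}"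
      "\<And>x y. x \<in> S \<Longrightarrow> y \<in> S \<Longrightarrow> d x y \<le> real (m + 1)" "\<And>U. U \<in> \<V> \<Longrightarrow> U \<inter> S \<noteq> {}"
      using bounded_cover_multiplicity[OF \<U>, where N = "m + 1"] by blast
    obtain x where x: "x \<in> S" using \<V> by blast
    have "S \<subseteq> mball x (m + 2)"
    proof
      fix y assume "y \<in> S"
      then show "y \<in> mball x (m + 2)" using \<V>(3) \<V>(5)[OF x, of y] x by auto
    qed
    then have "\<V> \<subseteq> {U\<in>\<U>. U \<inter> mball x (m + 2) \<noteq> {}}"
      using \<V>(1,6) by blast
    then have "card \<V> \<le> m + 1"
      using bspec[OF mult, of x] x \<V>(3) by (meson card_mono in_mono order_trans)
    then show False using \<V>(2) by simp
  qed
qed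

theorem assouad_nagata_dimension_infinite: "assouad_nagata_dimension = \<infinity>"
  unfolding assouad_nagata_dimension_def
proof (rule Inf_enat_eq_infinity, rule notI)
  fix m :: nat
  assume "\<exists>c>0. \<forall>r>0. \<exists>\<U>. \<Union>\<U> = M \<and> (\<forall>U\<in>\<U>. diam U \<le> ennreal (c * r)) \<and>
    (\<forall>S\<subseteq>M. diam S \<le> ennreal r \<longrightarrow>
       finite {U\<in>\<U>. U \<inter> S \<noteq> {}} \<and> card {U\<in>\<U>. U \<inter> S \<noteq> {}} \<le> m + 1)"
  then obtain c where m: "\<And>r. 0 < r \<Longrightarrow> \<exists>\<U>. \<Union>\<U> = M \<and> (\<forall>U\<in>\<U>. diam U \<le> ennreal (c * r)) \<and>
    (\<forall>S\<subseteq>M. diam S \<le> ennreal r \<longrightarrow>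
       finite {U\<in>\<U>. U \<inter> S \<noteq> {}} \<and> card {U\<in>\<U>. U \<inter> S \<noteq> {}} \<le> m + 1)"
    by blast
  show False
  proof -
    obtain \<U> where \<U>: "\<Union>\<U> = M" "\<And>U. U \<in> \<U> \<Longrightarrow> diam U \<le> ennreal (c * real (m + 1))"
      and mult: "\<And>S. S \<subseteq> M \<Longrightarrow> diam S \<le> ennreal (real (m + 1)) \<Longrightarrow>
          finite {U\<in>\<U>. U \<inter> S \<noteq> {}} \<and> card {U\<in>\<U>. U \<inter> S \<noteq> {}} \<le> m + 1"
      using m[of "real (m + 1)"] by auto
    obtain \<V> S where \<V>: "\<V> \<subseteq> \<U>" "card \<V> = (m + 1) + 1" "S \<subseteq> M" "S \<noteq> {}"
      "\<And>x y. x \<in> S \<Longrightarrow> y \<in> S \<Longrightarrow> d x y \<le> real (m + 1)" "\<And>U. U \<in> \<V> \<Longrightarrow> U \<inter> S \<noteq> {}"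
      using bounded_cover_multiplicity[OF \<U>, where N = "m + 1"] by blast
    have "diam S \<le> ennreal (real (m + 1))"
      using \<V>(5) unfolding diam_le_iff by (blast intro: ennreal_leI)
    moreover have "\<V> \<subseteq> {U\<in>\<U>. U \<inter> S \<noteq> {}}"
      using \<V>(1,6) by blast
    ultimately have "card \<V> \<le> m + 1"
      using mult[OF \<V>(3)] by (meson card_mono order_trans)
    then show False using \<V>(2) by simp
  qed
qed

text \<open>
  Already the images of the origin and of the \<open>N\<close> unit vectors show this: the latter all lie in one
  ball of radius \<open>2\<close>, while a ball of radius \<open>1/2\<close> contains at most one of them.
\<close>
theorem assouad_dimension_infinite: "assouad_dimension = \<infinity>"
  unfolding assouad_dimension_def
proof (rule Inf_ennreal_eq_infinity, rule notI)
  fix s :: real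
  assume "0 \<le> s \<and> (\<exists>C>0. \<forall>r R. 0 < r \<and> r < R \<longrightarrow> (\<forall>x\<in>M.
    \<exists>F\<subseteq>M. finite F \<and> real (card F) \<le> C * (R / r) powr s \<and> mball x R \<subseteq> (\<Union>y\<in>F. mball y r)))"
  then obtain C where cov: "\<forall>r R. 0 < r \<and> r < R \<longrightarrow> (\<forall>x\<in>M.
    \<exists>F\<subseteq>M. finite F \<and> real (card F) \<le> C * (R / r) powr s \<and> mball x R \<subseteq> (\<Union>y\<in>F. mball y r))"
    by blast
  show False
  proof -
    obtain N :: nat where N: "C * 4 powr s < real N"
      using reals_Archimedean2 by blast
    obtain f where f: "cube_embedding N 1 f"
      using cubes[OF zero_less_one] by blast
    note f_M = cube_embedding_mem[OF f]
      and lower = cube_embedding_lower[OF f]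
      and upper = cube_embedding_upper[OF f]
    define e :: "nat \<Rightarrow> nat \<Rightarrow> real" where "e k = (\<lambda>i. if i = k then 1 else 0)" for k
    define z :: "nat \<Rightarrow> real" where "z = (\<lambda>i. 0)"
    have e_cube: "e k \<in> cube N 1" for k by (simp add: e_def cube_def)
    have z_cube: "z \<in> cube N 1" by (simp add: z_def cube_def)
    have near: "f (e k) \<in> mball (f z) 2" if "k < N" for k
    proof -
      have "(\<Sum>i<N. \<bar>z i - e k i\<bar>) = (\<Sum>i<N. if i = k then 1 else 0)"
        by (rule sum.cong) (auto simp: e_def z_def)
      also have "\<dots> = 1" using that by simp
      finally show ?thesis
        using upper[OF z_cube e_cube, of k] f_M[OF z_cube] f_M[OF e_cube] by simp
    qed
    have far: "1 \<le> d (f (e k)) (f (e l))" if "k < N" "k \<noteq> l" for k l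
      using lower[OF e_cube e_cube that(1), of k l] that by (simp add: e_def)
    obtain F where F: "F \<subseteq> M" "finite F" "real (card F) \<le> C * 4 powr s"
      "mball (f z) 2 \<subseteq> (\<Union>y\<in>F. mball y (1/2))"
      using cov[rule_format, of "1/2" 2 "f z"] f_M[OF z_cube] by auto
    have "\<exists>y\<in>F. f (e k) \<in> mball y (1/2)" if "k < N" for k
      using near[OF that] F(4) by blast
    then obtain h where h: "\<And>k. k < N \<Longrightarrow> h k \<in> F \<and> f (e k) \<in> mball (h k) (1/2)"
      by metis
    have "inj_on h {..<N}"
    proof (rule inj_onI, rule ccontr)
      fix k l assume kl: "k \<in> {..<N}" "l \<in> {..<N}" "h k = h l" "k \<noteq> l"
      have "d (f (e k)) (f (e l)) \<le> d (h k) (f (e k)) + d (h k) (f (e l))"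
        using h[of k] h[of l] kl by (metis commute in_mball lessThan_iff triangle)
      also have "\<dots> < 1"
        using h[of k] h[of l] kl by auto
      finally show False using far[of k l] kl by simp
    qed
    moreover have "h ` {..<N} \<subseteq> F" using h by auto
    ultimately have "N \<le> card F"
      by (metis F(2) card_inj_on_le card_lessThan)
    then show False using F(3) N by simp
  qed
qed

text \<open>
  The finite cover that admits no good refinement consists of the sets \<open>W b\<close>, where \<open>b\<close> selects one
  of each pair of opposite faces and \<open>W b\<close> is the complement of the closures of the selected faces.
  Opposite faces have positive distance, so these sets cover the space; and a member of a refinement
  cannot touch two opposite faces. Colouring a fine grid by members that contain a whole ball around
  the grid point turns a rainbow cell into a single point of high multiplicity.
\<close>
theorem covering_dimension_infinite: "covering_dimension mtopology = \<infinity>"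
  unfolding covering_dimension_def
proof (rule Inf_enat_eq_infinity, rule notI)
  fix m :: nat
  assume refinement: "\<forall>\<U>. finite \<U> \<and> (\<forall>U\<in>\<U>. openin mtopology U) \<and> \<Union>\<U> = topspace mtopology \<longrightarrow>
    (\<exists>\<V>. (\<forall>V\<in>\<V>. openin mtopology V) \<and> \<Union>\<V> = topspace mtopology \<and> (\<forall>V\<in>\<V>. \<exists>U\<in>\<U>. V \<subseteq> U) \<and>
      (\<forall>x\<in>topspace mtopology. finite {V\<in>\<V>. x \<in> V} \<and> card {V\<in>\<V>. x \<in> V} \<le> m + 1))"
  define N where "N = m + 1"
  obtain f where f: "cube_embedding N 1 f"
    using cubes[OF zero_less_one] by blast
  note f_M = cube_embedding_mem[OF f]
    and lower = cube_embedding_lower[OF f]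
    and upper = cube_embedding_upper[OF f]

  \<comment> \<open>\<open>face i False\<close> and \<open>face i True\<close> are the images of the opposite faces of the unit cube in direction \<open>i\<close>.\<close>
  define face where "face i b = f ` {s \<in> cube N 1. s i = of_bool b}" for i b
  have face_M: "face i b \<subseteq> M" for i b
    using f_M by (auto simp: face_def)
  have faces_apart: "1 \<le> d x y" if "i < N" "x \<in> face i False" "y \<in> face i True" for i x y
    using that lower by (fastforce simp: face_def)
  define W where "W b = M - (\<Union>i<N. mtopology closure_of (face i (b i)))" for b
  define \<U> where "\<U> = W ` ({..<N} \<rightarrow>\<^sub>E UNIV)"
  have "finite \<U>"
    unfolding \<U>_def by (intro finite_imageI finite_PiE) auto
  moreover have "\<forall>U\<in>\<U>. openin mtopology U"
  proof
    fix U assume "U \<in> \<U>"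
    then obtain b where "U = W b" by (auto simp: \<U>_def)
    moreover have "openin mtopology (topspace mtopology - (\<Union>i<N. mtopology closure_of (face i (b i))))"
      by (intro openin_diff openin_topspace closedin_Union) auto
    ultimately show "openin mtopology U" by (simp add: W_def)
  qed
  moreover have "\<Union>\<U> = topspace mtopology"
  proof
    show "\<Union>\<U> \<subseteq> topspace mtopology" by (auto simp: \<U>_def W_def)
    show "topspace mtopology \<subseteq> \<Union>\<U>"
    proof
      fix x assume "x \<in> topspace mtopology"
      then have "x \<in> M" by simp
      have "\<exists>b. x \<notin> mtopology closure_of (face i b)" if "i < N" for i
      proof (rule ccontr)
        assume "\<not> (\<exists>b. x \<notin> mtopology closure_of (face i b))"
        then have "x \<in> mtopology closure_of (face i b)" for b by simp
        then have "\<forall>r>0. \<exists>y\<in>face i b. y \<in> mball x r" for b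
          unfolding metric_closure_of by blast
        moreover have "0 < (1/2 :: real)" by simp
        ultimately have "\<exists>y\<in>face i b. y \<in> mball x (1/2)" for b by blast
        then obtain y z where yz: "y \<in> face i False" "y \<in> mball x (1/2)" "z \<in> face i True" "z \<in> mball x (1/2)"
          by meson
        then have "d y z \<le> d x y + d x z" "d x y < 1/2" "d x z < 1/2"
          using triangle[of y x z] commute[of x y] by auto
        then show False using faces_apart[OF that yz(1,3)] by linarith
      qed
      then obtain b where b: "\<And>i. i < N \<Longrightarrow> x \<notin> mtopology closure_of (face i (b i))"
        by metis
      then have "x \<in> W (restrict b {..<N})"
        using \<open>x \<in> M\<close> by (auto simp: W_def)
      then show "x \<in> \<Union>\<U>" by (auto simp: \<U>_def)
    qed
  qed
  ultimately have "finite \<U> \<and> (\<forall>U\<in>\<U>. openin mtopology U) \<and> \<Union>\<U> = topspace mtopology"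
    by blast
  from mp[OF spec[OF refinement] this, unfolded topspace_mtopology]
  obtain \<V> where \<V>_open: "\<forall>V\<in>\<V>. openin mtopology V" and \<V>_cover: "\<Union>\<V> = M"
    and \<V>_refines: "\<forall>V\<in>\<V>. \<exists>U\<in>\<U>. V \<subseteq> U"
    and mult: "\<forall>x\<in>M. finite {V\<in>\<V>. x \<in> V} \<and> card {V\<in>\<V>. x \<in> V} \<le> m + 1"
    by (elim exE conjE)
  have one_face: "\<not> (V \<inter> face i False \<noteq> {} \<and> V \<inter> face i True \<noteq> {})" if "V \<in> \<V>" "i < N" for V i
  proof -
    obtain b where "V \<subseteq> W b" using bspec[OF \<V>_refines \<open>V \<in> \<V>\<close>] by (auto simp: \<U>_def)
    then have "V \<inter> face i (b i) = {}"
      using closure_of_subset[of "face i (b i)" mtopology] face_M \<open>i < N\<close> by (fastforce simp: W_def)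
    then show ?thesis by (cases "b i") auto
  qed

  \<comment> \<open>The image of the cube is compact, which provides a Lebesgue number for \<open>\<V>\<close> on it.\<close>
  define X where "X = product_topology (\<lambda>i. top_of_set {0..1::real}) {..<N}"
  have X_space: "topspace X = {..<N} \<rightarrow>\<^sub>E {0..1}" by (simp add: X_def)
  have X_cube: "topspace X \<subseteq> cube N 1" unfolding X_space by (rule PiE_subset_cube)
  have "compact_space X"
    unfolding X_def by (simp add: compact_space_product_topology compact_space_subtopology)
  moreover have "continuous_map X mtopology f"
    unfolding continuous_map_to_metric
  proof (intro ballI allI impI)
    fix s and \<epsilon> :: real assume s: "s \<in> topspace X" and "\<epsilon> > 0"
    define \<eta> where "\<eta> = \<epsilon> / N"
    have "\<eta> > 0" using \<open>\<epsilon> > 0\<close> by (simp add: \<eta>_def N_def)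
    define B where "B = (\<Pi>\<^sub>E i\<in>{..<N}. {0..1} \<inter> ball (s i) \<eta>)"
    have "openin X B"
      unfolding X_def B_def by (auto simp: openin_PiE_gen openin_open_Int)
    moreover have "s \<in> B"
      using s \<open>\<eta> > 0\<close> by (auto simp: B_def X_space PiE_iff)
    moreover have "f t \<in> mball (f s) \<epsilon>" if "t \<in> B" for t
    proof -
      have t: "t \<in> topspace X" using that by (auto simp: B_def X_space PiE_iff)
      have "d (f s) (f t) \<le> (\<Sum>i<N. \<bar>s i - t i\<bar>)"
        using upper s t X_cube by blast
      also have "\<dots> < (\<Sum>i<N. \<eta>)"
        using that by (intro sum_strict_mono) (auto simp: B_def PiE_iff dist_real_def N_def)
      also have "\<dots> = \<epsilon>" by (simp add: \<eta>_def N_def)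
      finally show ?thesis using f_M s t X_cube by auto
    qed
    ultimately show "\<exists>U. openin X U \<and> s \<in> U \<and> (\<forall>t\<in>U. f t \<in> mball (f s) \<epsilon>)" by blast
  qed
  ultimately have "compactin mtopology (f ` topspace X)"
    using image_compactin compact_space_def by blast
  moreover have "f ` topspace X \<subseteq> \<Union>\<V>"
    unfolding \<V>_cover using f_M X_cube by (intro image_subsetI) blast
  ultimately obtain \<epsilon> where "\<epsilon> > 0" and \<epsilon>: "\<And>x. x \<in> f ` topspace X \<Longrightarrow> \<exists>V\<in>\<V>. mball x \<epsilon> \<subseteq> V"
    using lebesgue_number \<V>_open by metis
  \<comment> \<open>With mesh \<open>1 / P\<close> the image of a cell has diameter at most \<open>N / P\<close>, below the Lebesgue number.\<close>
  obtain P :: nat where P: "real N / \<epsilon> < real P"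
    using reals_Archimedean2 by blast
  then have "0 < P"
    using \<open>\<epsilon> > 0\<close> by (metis N_def divide_nonneg_pos gr0I of_nat_0 of_nat_0_le_iff not_less)
  define pt where "pt x = (\<lambda>i\<in>{..<N}. real (x i) / P)" for x :: "nat \<Rightarrow> nat"
  have pt: "pt x \<in> topspace X" if "\<forall>j. x j \<le> P" for x
    using that \<open>0 < P\<close> by (auto simp: pt_def X_space)
  define c where "c x = (SOME V. V \<in> \<V> \<and> mball (f (pt x)) \<epsilon> \<subseteq> V)" for x
  have c: "c x \<in> \<V> \<and> mball (f (pt x)) \<epsilon> \<subseteq> c x" if "\<forall>j. x j \<le> P" for x
  proof -
    have "\<exists>V. V \<in> \<V> \<and> mball (f (pt x)) \<epsilon> \<subseteq> V" using \<epsilon> pt[OF that] by blast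
    then show ?thesis unfolding c_def by (rule someI_ex)
  qed
  have in_c: "f (pt x) \<in> c x" if "\<forall>j. x j \<le> P" for x
    using c[OF that] f_M pt[OF that] X_cube \<open>\<epsilon> > 0\<close> by (meson centre_in_mball_iff in_mono)
  have faces: "c x \<noteq> c y"
    if *: "\<forall>j. x j \<le> P" "\<forall>j. y j \<le> P" "i < N" "x i = 0" "y i = P" for x y i
  proof -
    have "f (pt x) \<in> face i False" "f (pt y) \<in> face i True"
      using pt[OF *(1)] pt[OF *(2)] X_cube * \<open>0 < P\<close> by (auto simp: face_def pt_def)
    then show ?thesis
      using one_face[of "c x" i] c[OF *(1)] in_c[OF *(1)] in_c[OF *(2)] \<open>i < N\<close> by auto
  qed
  obtain q S where card_S: "card (c ` S) = N + 1"
    and cell: "\<forall>x\<in>S. \<forall>i. q i \<le> x i \<and> x i \<le> q i + 1 \<and> x i \<le> P"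
    by (rule grid_colouring_rainbow_cell[of P N c, OF \<open>0 < P\<close> faces])
  have grid: "\<forall>j. x j \<le> P" if "x \<in> S" for x
    using cell that by blast
  \<comment> \<open>Any vertex of the rainbow cell is so close to the other vertices that it lies in all their colours.\<close>
  have "S \<noteq> {}" using card_S by auto
  then obtain z where z: "z \<in> S" by blast
  have z_M: "f (pt z) \<in> M" using f_M pt[OF grid[OF z]] X_cube by blast
  have "f (pt z) \<in> c x" if x: "x \<in> S" for x
  proof -
    have "d (f (pt x)) (f (pt z)) \<le> (\<Sum>i<N. \<bar>pt x i - pt z i\<bar>)"
      using upper pt[OF grid[OF x]] pt[OF grid[OF z]] X_cube by blast
    also have "\<dots> \<le> (\<Sum>i<N. 1 / P)"
    proof (rule sum_mono)
      fix i assume "i \<in> {..<N}"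
      have "q i \<le> x i \<and> x i \<le> q i + 1" "q i \<le> z i \<and> z i \<le> q i + 1"
        using cell x z by blast+
      then have "\<bar>real (x i) - real (z i)\<bar> \<le> 1" by linarith
      then show "\<bar>pt x i - pt z i\<bar> \<le> 1 / P"
        using \<open>i \<in> {..<N}\<close> \<open>0 < P\<close> by (simp add: pt_def flip: diff_divide_distrib abs_divide) (simp add: divide_right_mono)
    qed
    also have "\<dots> < \<epsilon>" using P \<open>0 < P\<close> \<open>\<epsilon> > 0\<close> by (simp add: field_simps)
    finally have "f (pt z) \<in> mball (f (pt x)) \<epsilon>"
      using z_M f_M pt[OF grid[OF x]] X_cube by auto
    then show ?thesis using c[OF grid[OF x]] by blast
  qed
  then have "c ` S \<subseteq> {V\<in>\<V>. f (pt z) \<in> V}"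
    using c grid by blast
  then have "card (c ` S) \<le> m + 1"
    using bspec[OF mult z_M] by (meson card_mono order_trans)
  then show False using card_S by (simp add: N_def)
qed

text \<open>
  The mass distribution principle, applied to Lebesgue measure on the unit cube of a dimension
  \<open>N \<ge> s\<close>: since the embedding does not decrease differences of coordinates, a set of diameter
  \<open>\<delta>\<close> pulls back into a box with sides \<open>2 \<delta>\<close>. Hence a cover by sets of diameters
  \<open>\<delta> i \<le> 1\<close> satisfies \<open>1 \<le> (\<Sum>i. (2 * \<delta> i) ^ N) \<le> 2 ^ N * (\<Sum>i. \<delta> i powr s)\<close>.
\<close>
theorem hausdorff_dimension_infinite: "hausdorff_dimension = \<infinity>"
  unfolding hausdorff_dimension_def
proof (rule Inf_ennreal_eq_infinity, rule notI)
  fix s :: real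
  assume s: "s > 0 \<and> hausdorff_measure s = 0"
  obtain N :: nat where N: "s \<le> real N"
    using real_arch_simple by blast
  then have "0 < N" using s by (metis gr0I not_less of_nat_0)
  obtain f where f: "cube_embedding N 1 f"
    using cubes[OF zero_less_one] by blast
  note f_M = cube_embedding_mem[OF f]
    and lower = cube_embedding_lower[OF f]
  define \<mu> where "\<mu> = PiM {..<N} (\<lambda>_::nat. lborel :: real measure)"
  interpret product_sigma_finite "\<lambda>_::nat. lborel :: real measure" ..
  define C where "C = {..<N} \<rightarrow>\<^sub>E {0..1::real}"
  have C_cube: "C \<subseteq> cube N 1" unfolding C_def by (rule PiE_subset_cube)
  have box_sets: "(\<Pi>\<^sub>E j\<in>{..<N}. {a j..b j}) \<in> sets \<mu>" for a b :: "nat \<Rightarrow> real"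
    unfolding \<mu>_def by (intro sets_PiM_I_finite) auto
  have "emeasure \<mu> C = 1"
    unfolding \<mu>_def C_def by (subst emeasure_PiM) auto

  have "hausdorff_premeasure s 1 \<le> hausdorff_measure s"
    unfolding hausdorff_measure_def by (rule SUP_upper) simp
  then have "hausdorff_premeasure s 1 = 0" using s by simp
  then have "hausdorff_premeasure s 1 < ennreal ((1/2) ^ N)" by simp
  then obtain U :: "nat \<Rightarrow> 'a set"
    where diam_U: "\<forall>i. U i \<subseteq> M \<and> diam (U i) \<le> ennreal 1" and U_cover: "(\<Union>i. U i) = M"
      and small: "(\<Sum>i. ennreal (enn2real (diam (U i)) powr s)) < ennreal ((1/2) ^ N)"
    unfolding hausdorff_premeasure_def Inf_less_iff by (elim bexE CollectE exE conjE) simp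
  have diam_le: "diam (U i) \<le> ennreal 1" for i
    using diam_U by blast
  have diam_finite: "diam (U i) < \<infinity>" for i
    using order_le_less_trans[OF diam_le ennreal_less_top] by simp
  define \<delta> where "\<delta> i = enn2real (diam (U i))" for i
  have \<delta>_0: "0 \<le> \<delta> i" for i by (simp add: \<delta>_def)
  have \<delta>_1: "\<delta> i \<le> 1" for i
    using enn2real_mono[OF diam_le] by (simp add: \<delta>_def)
  have "\<exists>B. B \<in> sets \<mu> \<and> {t \<in> C. f t \<in> U i} \<subseteq> B \<and> emeasure \<mu> B \<le> ennreal ((2 * \<delta> i) ^ N)" for i
  proof (cases "\<exists>t \<in> C. f t \<in> U i")
    case True
    then obtain a where a: "a \<in> C" "f a \<in> U i" by blast
    define B where "B = (\<Pi>\<^sub>E j\<in>{..<N}. {a j - \<delta> i..a j + \<delta> i})"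
    have "{t \<in> C. f t \<in> U i} \<subseteq> B"
    proof
      fix t assume t: "t \<in> {t \<in> C. f t \<in> U i}"
      have "\<bar>a j - t j\<bar> \<le> \<delta> i" if "j < N" for j
        using lower[of a t j] dist_le_enn2real_diam[OF diam_finite a(2), of "f t"] t a C_cube that
        by (fastforce simp: \<delta>_def)
      then show "t \<in> B" using t by (fastforce simp: B_def C_def PiE_iff abs_le_iff)
    qed
    moreover have "emeasure \<mu> B = ennreal ((2 * \<delta> i) ^ N)"
      unfolding \<mu>_def B_def using \<delta>_0[of i]
      by (subst emeasure_PiM) (auto simp: ennreal_power)
    moreover have "B \<in> sets \<mu>" unfolding B_def by (rule box_sets)
    ultimately show ?thesis by (intro exI[of _ B]) simp
  next
    case False
    then show ?thesis by (intro exI[of _ "{}"]) auto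
  qed
  then have "\<forall>i. \<exists>B. B \<in> sets \<mu> \<and> {t \<in> C. f t \<in> U i} \<subseteq> B \<and> emeasure \<mu> B \<le> ennreal ((2 * \<delta> i) ^ N)"
    by blast
  from choice[OF this] obtain B where "\<forall>i. B i \<in> sets \<mu> \<and> {t \<in> C. f t \<in> U i} \<subseteq> B i \<and>
    emeasure \<mu> (B i) \<le> ennreal ((2 * \<delta> i) ^ N)" ..
  then have B: "\<And>i. B i \<in> sets \<mu>" "\<And>i. {t \<in> C. f t \<in> U i} \<subseteq> B i"
    "\<And>i. emeasure \<mu> (B i) \<le> ennreal ((2 * \<delta> i) ^ N)"
    by blast+
  have "C \<subseteq> (\<Union>i. B i)"
  proof
    fix t assume "t \<in> C"
    then obtain i where "f t \<in> U i" using f_M C_cube U_cover by blast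
    then show "t \<in> (\<Union>i. B i)" using B(2) \<open>t \<in> C\<close> by blast
  qed
  then have "emeasure \<mu> C \<le> emeasure \<mu> (\<Union>i. B i)"
    using B(1) by (intro emeasure_mono) auto
  also have "\<dots> \<le> (\<Sum>i. emeasure \<mu> (B i))"
    using B(1) by (intro emeasure_subadditive_countably) auto
  also have "\<dots> \<le> (\<Sum>i. ennreal (2 ^ N) * ennreal (\<delta> i powr s))"
  proof (intro suminf_le allI)
    fix i
    have "\<delta> i ^ N \<le> \<delta> i powr s"
    proof (cases "\<delta> i = 0")
      case True then show ?thesis using \<open>0 < N\<close> by (simp add: zero_power)
    next
      case False
      then have "0 < \<delta> i" using \<delta>_0[of i] by linarith
      then show ?thesis
        using powr_mono'[OF N \<delta>_0[of i] \<delta>_1[of i]] by (simp add: powr_realpow)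
    qed
    then have "(2 * \<delta> i) ^ N \<le> 2 ^ N * (\<delta> i powr s)"
      by (simp add: power_mult_distrib)
    then have "ennreal ((2 * \<delta> i) ^ N) \<le> ennreal (2 ^ N) * ennreal (\<delta> i powr s)"
      by (subst ennreal_mult[symmetric]) (auto intro: ennreal_leI)
    then show "emeasure \<mu> (B i) \<le> ennreal (2 ^ N) * ennreal (\<delta> i powr s)"
      using B(3)[of i] by (rule order_trans[rotated])
  qed auto
  also have "\<dots> = ennreal (2 ^ N) * (\<Sum>i. ennreal (\<delta> i powr s))"
    by simp
  also have "\<dots> < ennreal (2 ^ N) * ennreal ((1/2) ^ N)"
    using small by (intro ennreal_mult_strict_left_mono) (auto simp: \<delta>_def)
  also have "\<dots> = 1"
    by (simp add: power_one_over flip: ennreal_mult)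
  finally show False using \<open>emeasure \<mu> C = 1\<close> by simp
qed

end

section \<open>Inequalities between sums of powers\<close>

lemma powr_convex_nonneg:
  fixes x y u v p :: real
  assumes "1 \<le> p" "0 \<le> x" "0 \<le> y" "0 \<le> u" "0 \<le> v" "u + v = 1"
  shows "(u * x + v * y) powr p \<le> u * x powr p + v * y powr p"
proof -
  have le: "(w * z) powr p \<le> w * z powr p" if "0 \<le> w" "w \<le> 1" "0 \<le> z" for w z :: real
  proof -
    have "w powr p \<le> w" using powr_mono'[OF assms(1) that(1,2)] that(1) by simp
    then show ?thesis using that by (simp add: powr_mult mult_right_mono)
  qed
  consider "x = 0" | "y = 0" | "0 < x" "0 < y" using assms by linarith
  then show ?thesis
  proof cases
    case 1 then show ?thesis using le[of v y] assms by simp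
  next
    case 2 then show ?thesis using le[of u x] assms by simp
  next
    case 3
    then show ?thesis
      using convex_onD[OF powr_convex[OF assms(1)], of v x y] assms(4,5)
        eq_diff_eq[THEN iffD2, OF assms(6)] by simp
  qed
qed

text \<open>
  Minkowski's inequality, stated with upper bounds \<open>A\<close> and \<open>B\<close> for the two norms in place of the
  norms themselves. Strictly positive bounds allow division by them even where a norm vanishes. The
  proof is the convexity of \<open>t \<mapsto> t\<^sup>p\<close> for the weights \<open>A / (A + B)\<close> and \<open>B / (A + B)\<close>.
\<close>
lemma minkowski_sum_mset:
  fixes f g :: "'b \<Rightarrow> real"
  assumes "1 \<le> p" "0 < A" "0 < B"
    and nonneg: "\<And>x. 0 \<le> f x" "\<And>x. 0 \<le> g x"
    and f: "(\<Sum>x\<in>#\<Theta>. f x powr p) \<le> A powr p"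
    and g: "(\<Sum>x\<in>#\<Theta>. g x powr p) \<le> B powr p"
  shows "(\<Sum>x\<in>#\<Theta>. (f x + g x) powr p) \<le> (A + B) powr p"
proof -
  define u v where "u = A / (A + B)" and "v = B / (A + B)"
  have uv: "0 \<le> u" "0 \<le> v" "u + v = 1"
    using assms by (simp_all add: u_def v_def flip: add_divide_distrib)
  have AB: "(A + B) * u = A" "(A + B) * v = B"
    using assms(2,3) by (simp_all add: u_def v_def)
  define F G where "F = (A + B) powr p * (u / A powr p)" and "G = (A + B) powr p * (v / B powr p)"
  have "(f x + g x) powr p \<le> F * f x powr p + G * g x powr p" for x
  proof -
    have "f x + g x = (A + B) * (u * (f x / A) + v * (g x / B))"
      using AB assms(2,3) by (simp add: distrib_left flip: mult.assoc)
    then have "(f x + g x) powr p = (A + B) powr p * (u * (f x / A) + v * (g x / B)) powr p"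
      using assms(2,3) nonneg[of x] uv by (simp add: powr_mult)
    also have "\<dots> \<le> (A + B) powr p * (u * (f x / A) powr p + v * (g x / B) powr p)"
      using assms uv by (intro mult_left_mono powr_convex_nonneg) auto
    also have "\<dots> = F * f x powr p + G * g x powr p"
      using assms(2,3) nonneg[of x] by (simp add: F_def G_def powr_divide algebra_simps)
    finally show ?thesis .
  qed
  then have "(\<Sum>x\<in>#\<Theta>. (f x + g x) powr p) \<le> (\<Sum>x\<in>#\<Theta>. F * f x powr p + G * g x powr p)"
    by (rule sum_mset_mono)
  also have "\<dots> = F * (\<Sum>x\<in>#\<Theta>. f x powr p) + G * (\<Sum>x\<in>#\<Theta>. g x powr p)"
    by (simp add: sum_mset.distrib sum_mset_distrib_left)
  also have "\<dots> \<le> F * A powr p + G * B powr p"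
    using f g uv by (intro add_mono mult_left_mono) (auto simp: F_def G_def)
  also have "\<dots> = (A + B) powr p * (u + v)"
    using assms(2,3) by (simp add: F_def G_def algebra_simps)
  finally show ?thesis using uv by simp
qed

text \<open>
  Comparison of the \<open>\<ell>\<^sup>p\<close> with the \<open>\<ell>\<^sup>1\<close> norm: after scaling to \<open>\<ell>\<^sup>1\<close> norm \<open>1\<close> all entries are
  at most \<open>1\<close>, and raising them to the power \<open>p\<close> only decreases them.
\<close>
lemma powr_sum_le:
  fixes a :: "'b \<Rightarrow> real"
  assumes "1 \<le> p" "finite I" and nonneg: "\<And>i. i \<in> I \<Longrightarrow> 0 \<le> a i"
  shows "(\<Sum>i\<in>I. a i powr p) powr (1 / p) \<le> (\<Sum>i\<in>I. a i)"
proof (cases "(\<Sum>i\<in>I. a i) = 0")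
  case True
  then have "a i = 0" if "i \<in> I" for i
    using that assms(2) nonneg by (simp add: sum_nonneg_eq_0_iff)
  then show ?thesis by simp
next
  case False
  define S where "S = (\<Sum>i\<in>I. a i)"
  have "0 < S" using False sum_nonneg[of I a] nonneg by (simp add: S_def order_less_le)
  have "(\<Sum>i\<in>I. a i powr p) \<le> (\<Sum>i\<in>I. S powr p * (a i / S))"
  proof (rule sum_mono)
    fix i assume i: "i \<in> I"
    have "a i \<le> S" unfolding S_def using i assms(2) nonneg by (intro member_le_sum) auto
    then have "(a i / S) powr p \<le> a i / S"
      using powr_mono'[OF assms(1), of "a i / S"] nonneg[OF i] \<open>0 < S\<close> by simp
    then show "a i powr p \<le> S powr p * (a i / S)"
      using nonneg[OF i] \<open>0 < S\<close> by (simp add: powr_divide field_simps)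
  qed
  also have "\<dots> = S powr p"
    using \<open>0 < S\<close> by (simp add: S_def flip: sum_distrib_left sum_divide_distrib)
  finally have "(\<Sum>i\<in>I. a i powr p) powr (1 / p) \<le> (S powr p) powr (1 / p)"
    using assms(1) by (intro powr_mono2 sum_nonneg) auto
  then show ?thesis using assms(1) \<open>0 < S\<close> by (simp add: S_def powr_powr)
qed

section \<open>The Wasserstein distance through finite couplings\<close>

definition off :: "'a set \<Rightarrow> 'a multiset \<Rightarrow> 'a multiset" where
  "off A \<sigma> = filter_mset (\<lambda>x. x \<notin> A) \<sigma>"

lemma off_plus [simp]: "off A (\<sigma> + \<tau>) = off A \<sigma> + off A \<tau>"
  by (simp add: off_def)

lemma mem_off_iff [simp]: "x \<in># off A \<sigma> \<longleftrightarrow> x \<in># \<sigma> \<and> x \<notin> A"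
  by (auto simp: off_def)

lemma off_eq_empty: "set_mset \<alpha> \<subseteq> A \<Longrightarrow> off A \<alpha> = {#}"
  by (induction \<alpha>) (auto simp: off_def)

lemma off_decompose: "\<sigma> = off A \<sigma> + filter_mset (\<lambda>x. x \<in> A) \<sigma>"
  unfolding off_def by (metis multiset_partition union_commute)

lemma off_eq_imp_plus_eq:
  assumes "off A \<sigma> = off A \<tau>"
  shows "\<sigma> + filter_mset (\<lambda>x. x \<in> A) \<tau> = \<tau> + filter_mset (\<lambda>x. x \<in> A) \<sigma>"
  using off_decompose[of \<sigma> A] off_decompose[of \<tau> A] assms by (metis add.assoc add.commute)

lemma diagram_equiv_iff: "(\<sigma>, \<tau>) \<in> diagram_equiv A \<longleftrightarrow> off A \<sigma> = off A \<tau>"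
proof
  assume "(\<sigma>, \<tau>) \<in> diagram_equiv A"
  then obtain \<alpha> \<beta> where "set_mset \<alpha> \<subseteq> A" "set_mset \<beta> \<subseteq> A" "\<sigma> + \<alpha> = \<tau> + \<beta>"
    by (auto simp: diagram_equiv_def)
  then have "off A (\<sigma> + \<alpha>) = off A (\<tau> + \<beta>)" "off A \<alpha> = {#}" "off A \<beta> = {#}"
    by (simp_all add: off_eq_empty)
  then show "off A \<sigma> = off A \<tau>" by simp
next
  assume eq: "off A \<sigma> = off A \<tau>"
  let ?\<alpha> = "filter_mset (\<lambda>x. x \<in> A) \<tau>" and ?\<beta> = "filter_mset (\<lambda>x. x \<in> A) \<sigma>"
  have "\<sigma> + ?\<alpha> = \<tau> + ?\<beta>"
    by (rule off_eq_imp_plus_eq[OF eq])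
  moreover have "set_mset ?\<alpha> \<subseteq> A" "set_mset ?\<beta> \<subseteq> A" by auto
  ultimately show "(\<sigma>, \<tau>) \<in> diagram_equiv A"
    unfolding diagram_equiv_def by blast
qed

text \<open>
  Marginals are prescribed only outside \<open>A\<close>. This replaces the padding of both diagrams by points
  of \<open>A\<close>, and makes it evident that the equivalence class of a multiset is all that counts.
\<close>
definition coupling :: "'a set \<Rightarrow> 'a multiset \<Rightarrow> 'a multiset \<Rightarrow> ('a \<times> 'a) multiset \<Rightarrow> bool" where
  "coupling A \<sigma> \<tau> \<Gamma> \<longleftrightarrow>
    off A (image_mset fst \<Gamma>) = off A \<sigma> \<and> off A (image_mset snd \<Gamma>) = off A \<tau>"

definition coupling_cost :: "real \<Rightarrow> ('a::metric_space \<times> 'a) multiset \<Rightarrow> real" where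
  "coupling_cost p \<Gamma> = (\<Sum>z\<in>#\<Gamma>. dist (fst z) (snd z) powr p)"

lemma coupling_cost_nonneg: "0 \<le> coupling_cost p \<Gamma>"
  unfolding coupling_cost_def by (induction \<Gamma>) auto

lemma dist_le_coupling_cost:
  assumes "z \<in># \<Gamma>" "0 < p"
  shows "dist (fst z) (snd z) \<le> coupling_cost p \<Gamma> powr (1 / p)"
proof -
  obtain \<Gamma>' where "\<Gamma> = add_mset z \<Gamma>'" using assms(1) by (meson multi_member_split)
  then have "dist (fst z) (snd z) powr p \<le> coupling_cost p \<Gamma>"
    using coupling_cost_nonneg[of p \<Gamma>'] by (simp add: coupling_cost_def)
  then have "(dist (fst z) (snd z) powr p) powr (1 / p) \<le> coupling_cost p \<Gamma> powr (1 / p)"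
    using assms(2) by (intro powr_mono2) auto
  then show ?thesis using assms(2) by (simp add: powr_powr)
qed

lemma coupling_exists:
  assumes "a \<in> A"
  shows "\<exists>\<Gamma>. coupling A \<sigma> \<tau> \<Gamma>"
proof -
  have "off A (image_mset (\<lambda>x. a) \<mu>) = {#}" for \<mu> :: "'a multiset"
    using assms by (intro off_eq_empty) auto
  then have "coupling A \<sigma> \<tau> (image_mset (\<lambda>x. (x, a)) \<sigma> + image_mset (\<lambda>y. (a, y)) \<tau>)"
    by (simp add: coupling_def image_mset.compositionality comp_def)
  then show ?thesis by blast
qed

text \<open>
  Two finite families with the same multiset of values are reindexings of each other. This links
  multisets of pairs to bijections between sets of labelled copies.
\<close>
lemma bij_betw_of_image_mset_eq:
  assumes "finite G" "finite H" "image_mset h (mset_set G) = image_mset k (mset_set H)"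
  shows "\<exists>g. bij_betw g G H \<and> (\<forall>e\<in>G. k (g e) = h e)"
  using assms
proof (induction G arbitrary: H rule: finite_induct)
  case empty
  then have "mset_set H = {#}" by simp
  then have "H = {}" using empty by (simp add: mset_set_empty_iff)
  then show ?case by (simp add: bij_betw_def)
next
  case (insert e G)
  have "h e \<in># image_mset k (mset_set H)"
    using insert by (metis finite_insert finite_set_mset_mset_set image_eqI insertI1 set_image_mset)
  then obtain f where f: "f \<in> H" "k f = h e" using insert.prems by auto
  then have "mset_set H = add_mset f (mset_set (H - {f}))"
    using insert.prems(1) by (simp add: mset_set.remove)
  then have "image_mset h (mset_set G) = image_mset k (mset_set (H - {f}))"
    using insert f by simp
  then obtain g where g: "bij_betw g G (H - {f})" "\<forall>e\<in>G. k (g e) = h e"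
    using insert.IH[of "H - {f}"] insert.prems by auto
  have "bij_betw (g(e := f)) G (H - {f})"
    using g(1) insert.hyps(2) by (subst bij_betw_cong[of _ _ g]) auto
  then have "bij_betw (g(e := f)) (G \<union> {e}) ((H - {f}) \<union> {f})"
    by (intro bij_betw_combine) (auto simp: bij_betw_def)
  then have "bij_betw (g(e := f)) (insert e G) H"
    using f(1) by (simp add: insert_absorb)
  moreover have "\<forall>e'\<in>insert e G. k ((g(e := f)) e') = h e'"
    using g(2) f(2) by simp
  ultimately show ?case by blast
qed

lemma copies_count:
  shows finite_copies_count: "finite (copies (\<lambda>x. enat (count \<sigma> x)))"
    and image_mset_copies_count: "image_mset fst (mset_set (copies (\<lambda>x. enat (count \<sigma> x)))) = \<sigma>"
proof -
  have eq: "copies (\<lambda>x. enat (count \<sigma> x)) = (SIGMA x:set_mset \<sigma>. {..<count \<sigma> x})"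
    unfolding copies_def by (auto simp flip: count_greater_zero_iff)
  show fin: "finite (copies (\<lambda>x. enat (count \<sigma> x)))"
    unfolding eq by simp
  show "image_mset fst (mset_set (copies (\<lambda>x. enat (count \<sigma> x)))) = \<sigma>"
  proof (rule multiset_eqI)
    fix x
    have "count (image_mset fst (mset_set (copies (\<lambda>x. enat (count \<sigma> x))))) x =
        card {e \<in> copies (\<lambda>x. enat (count \<sigma> x)). fst e = x}"
      using fin by (simp add: count_image_mset_eq_card_vimage)
    also have "{e \<in> copies (\<lambda>x. enat (count \<sigma> x)). fst e = x} = Pair x ` {..<count \<sigma> x}"
      by (auto simp: copies_def)
    also have "card \<dots> = count \<sigma> x"
      by (simp add: card_image inj_on_def)
    finally show "count (image_mset fst (mset_set (copies (\<lambda>x. enat (count \<sigma> x))))) x = count \<sigma> x" .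
  qed
qed

lemma copies_plus_countable_off:
  fixes \<sigma> :: "'a multiset"
  assumes "countable_multiset_in A \<alpha>"
  defines "E \<equiv> {e \<in> copies (plus_countable \<sigma> \<alpha>). fst e \<notin> A}"
  shows "finite E" "image_mset fst (mset_set E) = off A \<sigma>"
proof -
  have "enat k < enat (count \<sigma> x) + \<alpha> x \<and> x \<notin> A \<longleftrightarrow> k < count (off A \<sigma>) x" for x k
  proof (cases "x \<in> A")
    case False
    then have "\<alpha> x = 0" using assms(1) by (auto simp: countable_multiset_in_def)
    then show ?thesis using False by (simp add: off_def)
  qed (simp add: off_def)
  then have "E = copies (\<lambda>x. enat (count (off A \<sigma>) x))"
    by (simp add: E_def copies_def plus_countable_def set_eq_iff)
  then show "finite E" "image_mset fst (mset_set E) = off A \<sigma>"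
    by (simp_all add: copies_count)
qed

text \<open>
  Only finitely many matched pairs have an end outside \<open>A\<close>, since \<open>\<sigma>\<close> and \<open>\<tau>\<close> are finite and
  the padding lies in \<open>A\<close>. These pairs form a coupling, and dropping the others can only lower the
  cost.
\<close>
lemma coupling_of_matching:
  assumes \<alpha>: "countable_multiset_in A \<alpha>" and \<beta>: "countable_multiset_in A \<beta>"
    and bij: "bij_betw \<phi> (copies (plus_countable \<sigma> \<alpha>)) (copies (plus_countable \<tau> \<beta>))"
  shows "\<exists>\<Gamma>. coupling A \<sigma> \<tau> \<Gamma> \<and>
    ennreal (coupling_cost p \<Gamma>) \<le> matching_cost p (copies (plus_countable \<sigma> \<alpha>)) \<phi>"
proof -
  define E E' where "E = copies (plus_countable \<sigma> \<alpha>)" and "E' = copies (plus_countable \<tau> \<beta>)"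
  define F1 F2 where "F1 = {e \<in> E. fst e \<notin> A}" and "F2 = {e \<in> E. fst (\<phi> e) \<notin> A}"
  have F1: "finite F1" "image_mset fst (mset_set F1) = off A \<sigma>"
    unfolding F1_def E_def by (rule copies_plus_countable_off[OF \<alpha>])+
  have bij': "bij_betw \<phi> F2 {e \<in> E'. fst e \<notin> A}"
    using bij unfolding F2_def E_def[symmetric] E'_def[symmetric]
    by (auto simp: bij_betw_def inj_on_def)
  have F2': "finite {e \<in> E'. fst e \<notin> A}" "image_mset fst (mset_set {e \<in> E'. fst e \<notin> A}) = off A \<tau>"
    unfolding E'_def by (rule copies_plus_countable_off[OF \<beta>])+
  have "finite F2" using bij_betw_finite[OF bij'] F2'(1) by simp
  have F2: "image_mset (\<lambda>e. fst (\<phi> e)) (mset_set F2) = off A \<tau>"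
  proof -
    have "image_mset \<phi> (mset_set F2) = mset_set {e \<in> E'. fst e \<notin> A}"
      using image_mset_mset_set[OF bij_betw_imp_inj_on[OF bij']] bij_betw_imp_surj_on[OF bij']
      by simp
    then have "image_mset fst (image_mset \<phi> (mset_set F2)) = off A \<tau>" using F2'(2) by simp
    then show ?thesis by (simp add: image_mset.compositionality comp_def)
  qed
  define F where "F = F1 \<union> F2"
  have "finite F" using F1 \<open>finite F2\<close> by (simp add: F_def)
  have F_filters: "{e \<in> F. fst e \<notin> A} = F1" "{e \<in> F. fst (\<phi> e) \<notin> A} = F2"
    by (auto simp: F_def F1_def F2_def)
  define \<Gamma> where "\<Gamma> = image_mset (\<lambda>e. (fst e, fst (\<phi> e))) (mset_set F)"
  have off_image: "off A (image_mset h (mset_set F)) = image_mset h (mset_set {e \<in> F. h e \<notin> A})" for h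
    unfolding off_def using \<open>finite F\<close> by (simp add: filter_mset_image_mset filter_mset_mset_set)
  have "coupling A \<sigma> \<tau> \<Gamma>"
    unfolding coupling_def \<Gamma>_def image_mset.compositionality comp_def fst_conv snd_conv off_image
      F_filters F1(2) F2 by simp
  moreover have "ennreal (coupling_cost p \<Gamma>) \<le> matching_cost p E \<phi>"
  proof -
    have "coupling_cost p \<Gamma> = (\<Sum>e\<in>F. dist (fst e) (fst (\<phi> e)) powr p)"
      by (simp add: coupling_cost_def \<Gamma>_def image_mset.compositionality comp_def sum_unfold_sum_mset)
    then have "ennreal (coupling_cost p \<Gamma>) = (\<Sum>e\<in>F. ennreal (dist (fst e) (fst (\<phi> e)) powr p))"
      by simp
    also have "\<dots> \<le> matching_cost p E \<phi>"
      unfolding matching_cost_def using \<open>finite F\<close>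
      by (subst nonneg_infsum_complete) (auto intro!: SUP_upper simp: F_def F1_def F2_def)
    finally show ?thesis .
  qed
  ultimately show ?thesis unfolding E_def by blast
qed

text \<open>
  The points of \<open>\<sigma>\<close> and \<open>\<tau>\<close> in \<open>A\<close> are ignored by a coupling. Adding a pair \<open>(a, a)\<close> for each of
  them costs nothing and makes the marginals equal to \<open>\<sigma>\<close> and \<open>\<tau>\<close> plus multisets in \<open>A\<close>.
\<close>
lemma matching_of_coupling:
  assumes "coupling A \<sigma> \<tau> \<Gamma>"
  shows "\<exists>\<alpha> \<beta> \<phi>. countable_multiset_in A \<alpha> \<and> countable_multiset_in A \<beta> \<and>
    bij_betw \<phi> (copies (plus_countable \<sigma> \<alpha>)) (copies (plus_countable \<tau> \<beta>)) \<and>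
    matching_cost p (copies (plus_countable \<sigma> \<alpha>)) \<phi> = ennreal (coupling_cost p \<Gamma>)"
proof -
  let ?on = "filter_mset (\<lambda>x. x \<in> A)"
  define \<Gamma>' where "\<Gamma>' = \<Gamma> + image_mset (\<lambda>a. (a, a)) (?on \<sigma> + ?on \<tau>)"
  define \<alpha> \<beta> where "\<alpha> = ?on (image_mset fst \<Gamma>) + ?on \<tau>" and "\<beta> = ?on (image_mset snd \<Gamma>) + ?on \<sigma>"
  have cost: "coupling_cost p \<Gamma>' = coupling_cost p \<Gamma>"
    by (simp add: coupling_cost_def \<Gamma>'_def image_mset.compositionality comp_def)
  have "image_mset fst \<Gamma> + ?on \<sigma> = \<sigma> + ?on (image_mset fst \<Gamma>)"
    using assms by (intro off_eq_imp_plus_eq) (simp add: coupling_def)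
  then have fst_\<Gamma>': "image_mset fst \<Gamma>' = \<sigma> + \<alpha>"
    by (simp add: \<Gamma>'_def \<alpha>_def image_mset.compositionality comp_def flip: add.assoc)
  have "image_mset snd \<Gamma> + ?on \<tau> = \<tau> + ?on (image_mset snd \<Gamma>)"
    using assms by (intro off_eq_imp_plus_eq) (simp add: coupling_def)
  then have snd_\<Gamma>': "image_mset snd \<Gamma>' = \<tau> + \<beta>"
    by (simp add: \<Gamma>'_def \<beta>_def image_mset.compositionality comp_def add_ac)
  let ?C = "\<lambda>\<mu>. copies (\<lambda>x. enat (count \<mu> x))"
  have "image_mset (\<lambda>e. fst (fst e)) (mset_set (?C \<Gamma>')) = image_mset fst (mset_set (?C (\<sigma> + \<alpha>)))"
  proof -
    have "image_mset (\<lambda>e. fst (fst e)) (mset_set (?C \<Gamma>')) = image_mset fst (image_mset fst (mset_set (?C \<Gamma>')))"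
      by (simp add: image_mset.compositionality comp_def)
    then show ?thesis by (simp only: image_mset_copies_count fst_\<Gamma>')
  qed
  then obtain g1 where g1: "bij_betw g1 (?C \<Gamma>') (?C (\<sigma> + \<alpha>))" "\<forall>e\<in>?C \<Gamma>'. fst (g1 e) = fst (fst e)"
    using bij_betw_of_image_mset_eq[OF finite_copies_count finite_copies_count] by blast
  have "image_mset (\<lambda>e. snd (fst e)) (mset_set (?C \<Gamma>')) = image_mset fst (mset_set (?C (\<tau> + \<beta>)))"
  proof -
    have "image_mset (\<lambda>e. snd (fst e)) (mset_set (?C \<Gamma>')) = image_mset snd (image_mset fst (mset_set (?C \<Gamma>')))"
      by (simp add: image_mset.compositionality comp_def)
    then show ?thesis by (simp only: image_mset_copies_count snd_\<Gamma>')
  qed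
  then obtain g2 where g2: "bij_betw g2 (?C \<Gamma>') (?C (\<tau> + \<beta>))" "\<forall>e\<in>?C \<Gamma>'. fst (g2 e) = snd (fst e)"
    using bij_betw_of_image_mset_eq[OF finite_copies_count finite_copies_count] by blast
  define \<phi> where "\<phi> = g2 \<circ> the_inv_into (?C \<Gamma>') g1"
  have \<phi>: "bij_betw \<phi> (?C (\<sigma> + \<alpha>)) (?C (\<tau> + \<beta>))"
    unfolding \<phi>_def by (rule bij_betw_trans[OF bij_betw_the_inv_into[OF g1(1)] g2(1)])
  have \<phi>_g1: "\<phi> (g1 e) = g2 e" if "e \<in> ?C \<Gamma>'" for e
    using g1(1) that by (simp add: \<phi>_def bij_betw_def the_inv_into_f_f)
  have "(\<Sum>e\<in>?C (\<sigma> + \<alpha>). dist (fst e) (fst (\<phi> e)) powr p)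
      = (\<Sum>e\<in>?C \<Gamma>'. dist (fst (g1 e)) (fst (\<phi> (g1 e))) powr p)"
    by (rule sum.reindex_bij_betw[OF g1(1), symmetric])
  also have "\<dots> = (\<Sum>e\<in>?C \<Gamma>'. dist (fst (fst e)) (snd (fst e)) powr p)"
    using g1(2) g2(2) \<phi>_g1 by (intro sum.cong) auto
  also have "\<dots> = (\<Sum>z\<in>#image_mset fst (mset_set (?C \<Gamma>')). dist (fst z) (snd z) powr p)"
    by (simp add: sum_unfold_sum_mset image_mset.compositionality comp_def)
  also have "\<dots> = coupling_cost p \<Gamma>'"
    by (simp add: image_mset_copies_count coupling_cost_def)
  finally have "matching_cost p (?C (\<sigma> + \<alpha>)) \<phi> = ennreal (coupling_cost p \<Gamma>)"
    unfolding matching_cost_def infsum_finite[OF finite_copies_count]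
    by (subst sum_ennreal) (simp_all add: cost)
  moreover have "?C (\<sigma> + \<alpha>) = copies (plus_countable \<sigma> (\<lambda>x. enat (count \<alpha> x)))"
    "?C (\<tau> + \<beta>) = copies (plus_countable \<tau> (\<lambda>x. enat (count \<beta> x)))"
    by (simp_all add: plus_countable_def)
  moreover have "countable_multiset_in A (\<lambda>x. enat (count \<mu> x))" if "set_mset \<mu> \<subseteq> A" for \<mu>
  proof -
    have "{x. enat (count \<mu> x) \<noteq> 0} = set_mset \<mu>" by (auto simp: zero_enat_def)
    then show ?thesis using that by (simp add: countable_multiset_in_def countable_finite)
  qed
  moreover have "set_mset \<alpha> \<subseteq> A" "set_mset \<beta> \<subseteq> A" by (auto simp: \<alpha>_def \<beta>_def)
  ultimately show ?thesis using \<phi> by metis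
qed

lemma wasserstein_eq_Inf_coupling:
  assumes "a \<in> A"
  shows "wasserstein p A \<sigma> \<tau> = (INF \<Gamma>\<in>{\<Gamma>. coupling A \<sigma> \<tau> \<Gamma>}. coupling_cost p \<Gamma>) powr (1 / p)"
proof -
  define I where "I = (INF \<Gamma>\<in>{\<Gamma>. coupling A \<sigma> \<tau> \<Gamma>}. coupling_cost p \<Gamma>)"
  define S where "S = {matching_cost p (copies (plus_countable \<sigma> \<alpha>)) \<phi> | \<alpha> \<beta> \<phi>.
        countable_multiset_in A \<alpha> \<and> countable_multiset_in A \<beta> \<and>
        bij_betw \<phi> (copies (plus_countable \<sigma> \<alpha>)) (copies (plus_countable \<tau> \<beta>))}"
  have nonempty: "{\<Gamma>. coupling A \<sigma> \<tau> \<Gamma>} \<noteq> {}"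
    using coupling_exists[OF assms] by blast
  have bdd: "bdd_below (coupling_cost p ` {\<Gamma>. coupling A \<sigma> \<tau> \<Gamma>})"
    using coupling_cost_nonneg by (intro bdd_belowI[of _ 0]) auto
  have "0 \<le> I"
    unfolding I_def using nonempty coupling_cost_nonneg by (intro cINF_greatest) auto
  have "Inf S = ennreal I"
  proof (rule antisym)
    show "ennreal I \<le> Inf S"
    proof (rule Inf_greatest)
      fix c assume "c \<in> S"
      then obtain \<Gamma> where \<Gamma>: "coupling A \<sigma> \<tau> \<Gamma>" "ennreal (coupling_cost p \<Gamma>) \<le> c"
        unfolding S_def using coupling_of_matching[of A _ _ _ \<sigma> \<tau> p] by blast
      have "I \<le> coupling_cost p \<Gamma>"
        unfolding I_def using bdd \<Gamma>(1) by (intro cINF_lower) auto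
      then show "ennreal I \<le> c"
        using \<Gamma>(2) ennreal_leI order_trans by blast
    qed
    show "Inf S \<le> ennreal I"
    proof (rule ennreal_le_epsilon)
      fix e :: real assume "0 < e"
      then obtain \<Gamma> where \<Gamma>: "coupling A \<sigma> \<tau> \<Gamma>" "coupling_cost p \<Gamma> < I + e"
        using cINF_less_iff[OF nonempty bdd, of "I + e"] by (auto simp: I_def)
      have "ennreal (coupling_cost p \<Gamma>) \<in> S"
        unfolding S_def using matching_of_coupling[OF \<Gamma>(1), of p] by force
      then have "Inf S \<le> ennreal (coupling_cost p \<Gamma>)" by (rule Inf_lower)
      also have "\<dots> \<le> ennreal (I + e)" using \<Gamma>(2) by (intro ennreal_leI) simp
      also have "\<dots> = ennreal I + ennreal e" using \<open>0 \<le> I\<close> \<open>0 < e\<close> by simp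
      finally show "Inf S \<le> ennreal I + ennreal e" .
    qed
  qed
  then show ?thesis
    unfolding wasserstein_def S_def[symmetric] I_def[symmetric] using \<open>0 \<le> I\<close> by simp
qed

lemma wasserstein_nonneg: "0 \<le> wasserstein p A \<sigma> \<tau>"
  by (simp add: wasserstein_def)

lemma wasserstein_le_coupling:
  assumes "a \<in> A" "0 < p" "coupling A \<sigma> \<tau> \<Gamma>"
  shows "wasserstein p A \<sigma> \<tau> \<le> coupling_cost p \<Gamma> powr (1 / p)"
proof -
  define I where "I = (INF \<Gamma>\<in>{\<Gamma>. coupling A \<sigma> \<tau> \<Gamma>}. coupling_cost p \<Gamma>)"
  have "bdd_below (coupling_cost p ` {\<Gamma>. coupling A \<sigma> \<tau> \<Gamma>})"
    using coupling_cost_nonneg by (intro bdd_belowI[of _ 0]) auto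
  then have "I \<le> coupling_cost p \<Gamma>"
    unfolding I_def using assms(3) by (intro cINF_lower) auto
  moreover have "0 \<le> I"
    unfolding I_def using assms(3) coupling_cost_nonneg by (intro cINF_greatest) auto
  ultimately show ?thesis
    unfolding wasserstein_eq_Inf_coupling[OF assms(1)] I_def[symmetric]
    using assms(2) by (intro powr_mono2) auto
qed

text \<open>
  As the \<open>p\<close>-th power is strictly increasing, approaching the infimum of the costs also approaches
  its \<open>p\<close>-th root.
\<close>
lemma near_optimal_coupling:
  assumes "a \<in> A" "0 < p" "0 < e"
  obtains \<Gamma> where "coupling A \<sigma> \<tau> \<Gamma>" "coupling_cost p \<Gamma> powr (1 / p) < wasserstein p A \<sigma> \<tau> + e"
proof -
  define I where "I = (INF \<Gamma>\<in>{\<Gamma>. coupling A \<sigma> \<tau> \<Gamma>}. coupling_cost p \<Gamma>)"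
  have nonempty: "{\<Gamma>. coupling A \<sigma> \<tau> \<Gamma>} \<noteq> {}"
    using coupling_exists[OF assms(1)] by blast
  have bdd: "bdd_below (coupling_cost p ` {\<Gamma>. coupling A \<sigma> \<tau> \<Gamma>})"
    using coupling_cost_nonneg by (intro bdd_belowI[of _ 0]) auto
  have "0 \<le> I"
    unfolding I_def using nonempty coupling_cost_nonneg by (intro cINF_greatest) auto
  define w where "w = wasserstein p A \<sigma> \<tau>"
  have "0 \<le> w" by (simp add: w_def wasserstein_nonneg)
  have "I = w powr p"
    using assms(2) \<open>0 \<le> I\<close>
    by (simp add: w_def wasserstein_eq_Inf_coupling[OF assms(1)] powr_powr flip: I_def)
  also have "\<dots> < (w + e) powr p"
    using assms \<open>0 \<le> w\<close> by (intro powr_less_mono2) auto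
  finally obtain \<Gamma> where \<Gamma>: "coupling A \<sigma> \<tau> \<Gamma>" "coupling_cost p \<Gamma> < (w + e) powr p"
    using cINF_less_iff[OF nonempty bdd] by (auto simp: I_def)
  have "coupling_cost p \<Gamma> powr (1 / p) < ((w + e) powr p) powr (1 / p)"
    using \<Gamma>(2) assms(2) coupling_cost_nonneg by (intro powr_less_mono2) auto
  also have "\<dots> = w + e" using assms \<open>0 \<le> w\<close> by (simp add: powr_powr)
  finally show ?thesis using that \<Gamma>(1) by (simp add: w_def)
qed

lemma wasserstein_cong_off:
  assumes "a \<in> A" "off A \<sigma> = off A \<sigma>'" "off A \<tau> = off A \<tau>'"
  shows "wasserstein p A \<sigma> \<tau> = wasserstein p A \<sigma>' \<tau>'"
  unfolding wasserstein_eq_Inf_coupling[OF assms(1)] coupling_def assms(2,3) ..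

lemma wasserstein_commute_le:
  assumes "a \<in> A" "0 < p"
  shows "wasserstein p A \<sigma> \<tau> \<le> wasserstein p A \<tau> \<sigma>"
proof (rule field_le_epsilon)
  fix e :: real assume "0 < e"
  then obtain \<Gamma> where \<Gamma>: "coupling A \<tau> \<sigma> \<Gamma>" "coupling_cost p \<Gamma> powr (1 / p) < wasserstein p A \<tau> \<sigma> + e"
    by (rule near_optimal_coupling[OF assms])
  let ?\<Gamma> = "image_mset prod.swap \<Gamma>"
  have "coupling A \<sigma> \<tau> ?\<Gamma>"
    using \<Gamma>(1) by (simp add: coupling_def image_mset.compositionality comp_def)
  moreover have "coupling_cost p ?\<Gamma> = coupling_cost p \<Gamma>"
    by (simp add: coupling_cost_def image_mset.compositionality comp_def dist_commute)
  ultimately show "wasserstein p A \<sigma> \<tau> \<le> wasserstein p A \<tau> \<sigma> + e"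
    using wasserstein_le_coupling[OF assms, of \<sigma> \<tau> ?\<Gamma>] \<Gamma>(2) by simp
qed

text \<open>
  The gluing lemma for measures in its simplest case: for multisets, the common marginal allows the
  pairs to be joined one at a time.
\<close>
lemma glue_multisets:
  fixes \<Gamma> :: "('a \<times> 'b) multiset" and \<Gamma>' :: "('b \<times> 'c) multiset"
  assumes "image_mset snd \<Gamma> = image_mset fst \<Gamma>'"
  shows "\<exists>\<Theta>. image_mset (\<lambda>t. (fst t, fst (snd t))) \<Theta> = \<Gamma> \<and> image_mset snd \<Theta> = \<Gamma>'"
  using assms
proof (induction \<Gamma> arbitrary: \<Gamma>')
  case empty
  then show ?case by (intro exI[of _ "{#}"]) simp
next
  case (add xy \<Gamma>)
  obtain x y where xy: "xy = (x, y)" by (cases xy)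
  have "y \<in># image_mset fst \<Gamma>'"
    using add.prems[symmetric] xy by simp
  then obtain z where "(y, z) \<in># \<Gamma>'" by auto
  then obtain \<Gamma>'' where \<Gamma>'': "\<Gamma>' = add_mset (y, z) \<Gamma>''" by (meson multi_member_split)
  then have "image_mset snd \<Gamma> = image_mset fst \<Gamma>''" using add.prems xy by simp
  from add.IH[OF this] obtain \<Theta> where
    "image_mset (\<lambda>t. (fst t, fst (snd t))) \<Theta> = \<Gamma> \<and> image_mset snd \<Theta> = \<Gamma>''" ..
  then show ?case
    using \<Gamma>'' xy by (intro exI[of _ "add_mset (x, y, z) \<Theta>"]) simp
qed

text \<open>
  The middle marginals of two couplings agree only outside \<open>A\<close>. Before gluing, each coupling is
  therefore enlarged by pairs \<open>(a, a)\<close> for the points in \<open>A\<close> of the other's middle marginal.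
\<close>
lemma wasserstein_triangle:
  assumes "a \<in> A" "1 \<le> p"
  shows "wasserstein p A \<sigma> \<rho> \<le> wasserstein p A \<sigma> \<tau> + wasserstein p A \<tau> \<rho>"
proof (rule field_le_epsilon)
  fix e :: real assume "0 < e"
  have "0 < p" using assms(2) by simp
  define w1 w2 where "w1 = wasserstein p A \<sigma> \<tau> + e / 2" and "w2 = wasserstein p A \<tau> \<rho> + e / 2"
  have w_pos: "0 < w1" "0 < w2"
    using \<open>0 < e\<close> wasserstein_nonneg[of p A] by (simp_all add: w1_def w2_def add_nonneg_pos)
  obtain \<Gamma>1 where \<Gamma>1: "coupling A \<sigma> \<tau> \<Gamma>1" "coupling_cost p \<Gamma>1 powr (1 / p) < w1"
    using near_optimal_coupling[OF assms(1) \<open>0 < p\<close> half_gt_zero[OF \<open>0 < e\<close>]] unfolding w1_def by blast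
  obtain \<Gamma>2 where \<Gamma>2: "coupling A \<tau> \<rho> \<Gamma>2" "coupling_cost p \<Gamma>2 powr (1 / p) < w2"
    using near_optimal_coupling[OF assms(1) \<open>0 < p\<close> half_gt_zero[OF \<open>0 < e\<close>]] unfolding w2_def by blast
  have cost_le: "coupling_cost p \<Gamma> \<le> w powr p" if "coupling_cost p \<Gamma> powr (1 / p) < w" for \<Gamma> :: "('a \<times> 'a) multiset" and w
  proof -
    have "(coupling_cost p \<Gamma> powr (1 / p)) powr p \<le> w powr p"
      using that \<open>0 < p\<close> by (intro powr_mono2) auto
    then show ?thesis using \<open>0 < p\<close> coupling_cost_nonneg by (simp add: powr_powr)
  qed
  let ?on = "filter_mset (\<lambda>x. x \<in> A)" and ?diag = "image_mset (\<lambda>a. (a, a))"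
  define \<Gamma>1' where "\<Gamma>1' = \<Gamma>1 + ?diag (?on (image_mset fst \<Gamma>2))"
  define \<Gamma>2' where "\<Gamma>2' = \<Gamma>2 + ?diag (?on (image_mset snd \<Gamma>1))"
  have cost': "coupling_cost p \<Gamma>1' = coupling_cost p \<Gamma>1" "coupling_cost p \<Gamma>2' = coupling_cost p \<Gamma>2"
    by (simp_all add: coupling_cost_def \<Gamma>1'_def \<Gamma>2'_def image_mset.compositionality comp_def)
  have "image_mset snd \<Gamma>1 + ?on (image_mset fst \<Gamma>2) = image_mset fst \<Gamma>2 + ?on (image_mset snd \<Gamma>1)"
  proof -
    have "off A (image_mset snd \<Gamma>1) = off A (image_mset fst \<Gamma>2)"
      using \<Gamma>1(1) \<Gamma>2(1) by (simp add: coupling_def)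
    then show ?thesis by (rule off_eq_imp_plus_eq)
  qed
  then have "image_mset snd \<Gamma>1' = image_mset fst \<Gamma>2'"
    by (simp add: \<Gamma>1'_def \<Gamma>2'_def image_mset.compositionality comp_def)
  from glue_multisets[OF this] obtain \<Theta> where \<Theta>:
    "image_mset (\<lambda>t. (fst t, fst (snd t))) \<Theta> = \<Gamma>1'" "image_mset snd \<Theta> = \<Gamma>2'"
    by blast
  define \<Gamma> where "\<Gamma> = image_mset (\<lambda>t. (fst t, snd (snd t))) \<Theta>"
  have off_on: "off A (?on \<mu>) = {#}" for \<mu> by (rule off_eq_empty) auto
  have "image_mset fst \<Gamma> = image_mset fst \<Gamma>1'" "image_mset snd \<Gamma> = image_mset snd \<Gamma>2'"
    unfolding \<Gamma>_def \<Theta>[symmetric] by (simp_all add: image_mset.compositionality comp_def case_prod_beta)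
  then have "coupling A \<sigma> \<rho> \<Gamma>"
    using \<Gamma>1(1) \<Gamma>2(1)
    by (simp add: coupling_def \<Gamma>1'_def \<Gamma>2'_def image_mset.compositionality comp_def off_on)
  define f g where "f t = dist (fst t) (fst (snd t))" and "g t = dist (fst (snd t)) (snd (snd t))" for t :: "'a \<times> 'a \<times> 'a"
  have "coupling_cost p \<Gamma> = (\<Sum>t\<in>#\<Theta>. dist (fst t) (snd (snd t)) powr p)"
    by (simp add: coupling_cost_def \<Gamma>_def image_mset.compositionality comp_def case_prod_beta)
  also have "\<dots> \<le> (\<Sum>t\<in>#\<Theta>. (f t + g t) powr p)"
    using \<open>0 < p\<close> by (intro sum_mset_mono powr_mono2) (auto simp: f_def g_def case_prod_beta dist_triangle)
  also have "\<dots> \<le> (w1 + w2) powr p"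
  proof (rule minkowski_sum_mset[OF assms(2) w_pos])
    show "0 \<le> f t" "0 \<le> g t" for t by (simp_all add: f_def g_def case_prod_beta)
    have "(\<Sum>t\<in>#\<Theta>. f t powr p) = coupling_cost p \<Gamma>1'"
      unfolding \<Theta>(1)[symmetric] coupling_cost_def f_def
      by (simp add: image_mset.compositionality comp_def case_prod_beta)
    then show "(\<Sum>t\<in>#\<Theta>. f t powr p) \<le> w1 powr p" using cost_le[OF \<Gamma>1(2)] cost' by simp
    have "(\<Sum>t\<in>#\<Theta>. g t powr p) = coupling_cost p \<Gamma>2'"
      unfolding \<Theta>(2)[symmetric] coupling_cost_def g_def
      by (simp add: image_mset.compositionality comp_def case_prod_beta)
    then show "(\<Sum>t\<in>#\<Theta>. g t powr p) \<le> w2 powr p" using cost_le[OF \<Gamma>2(2)] cost' by simp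
  qed
  finally have "coupling_cost p \<Gamma> powr (1 / p) \<le> ((w1 + w2) powr p) powr (1 / p)"
    using \<open>0 < p\<close> coupling_cost_nonneg by (intro powr_mono2) auto
  also have "\<dots> = w1 + w2" using \<open>0 < p\<close> w_pos by (simp add: powr_powr)
  finally show "wasserstein p A \<sigma> \<rho> \<le> wasserstein p A \<sigma> \<tau> + wasserstein p A \<tau> \<rho> + e"
    using wasserstein_le_coupling[OF assms(1) \<open>0 < p\<close> \<open>coupling A \<sigma> \<rho> \<Gamma>\<close>] by (simp add: w1_def w2_def)
qed

text \<open>
  As \<open>A\<close> is closed, the distances of the finitely many points outside \<open>A\<close> to \<open>A\<close> and to each other
  have a lower bound \<open>\<delta> > 0\<close>. A coupling that moves no point by \<open>\<delta>\<close> or more leaves all of them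
  in place.
\<close>
lemma off_eq_of_wasserstein_eq_0:
  assumes "closed A" "a \<in> A" "0 < p" "wasserstein p A \<sigma> \<tau> = 0"
  shows "off A \<sigma> = off A \<tau>"
proof -
  define S where "S = set_mset (off A \<sigma>) \<union> set_mset (off A \<tau>)"
  have "\<exists>r>0. \<forall>y\<in>A \<union> (S - {x}). r \<le> dist x y" if "x \<in> S" for x
  proof -
    have "closed (A \<union> (S - {x}))" by (rule closed_Un[OF assms(1) finite_imp_closed]) (simp add: S_def)
    moreover have "x \<notin> A \<union> (S - {x})" using that by (auto simp: S_def)
    ultimately obtain r where "0 < r" "ball x r \<subseteq> - (A \<union> (S - {x}))"
      using openE[OF open_Compl, of "A \<union> (S - {x})" x] by blast
    then show ?thesis by (intro exI[of _ r]) (fastforce simp: not_less)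
  qed
  then obtain r where r: "\<And>x. x \<in> S \<Longrightarrow> 0 < r x"
    "\<And>x y. x \<in> S \<Longrightarrow> y \<in> A \<union> (S - {x}) \<Longrightarrow> r x \<le> dist x y"
    by metis
  define \<delta> where "\<delta> = Min (insert 1 (r ` S))"
  have "finite S" by (simp add: S_def)
  then have "0 < \<delta>" using r(1) by (simp add: \<delta>_def)
  have \<delta>_le: "\<delta> \<le> dist x y" if "x \<in> S" "y \<in> A \<union> (S - {x})" for x y
  proof -
    have "\<delta> \<le> r x" using \<open>finite S\<close> that(1) by (simp add: \<delta>_def)
    then show ?thesis using r(2)[OF that] by simp
  qed
  obtain \<Gamma> where \<Gamma>: "coupling A \<sigma> \<tau> \<Gamma>" "coupling_cost p \<Gamma> powr (1 / p) < \<delta>"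
    using near_optimal_coupling[OF assms(2,3) \<open>0 < \<delta>\<close>, of \<sigma> \<tau>] assms(4) by auto
  have "\<forall>z\<in>#\<Gamma>. fst z = snd z \<or> (fst z \<in> A \<and> snd z \<in> A)"
  proof
    fix z assume z: "z \<in># \<Gamma>"
    have near: "dist (fst z) (snd z) < \<delta>"
      using dist_le_coupling_cost[OF z assms(3)] \<Gamma>(2) by simp
    have "fst z \<in> S" if "fst z \<notin> A"
    proof -
      have "fst z \<in># off A (image_mset fst \<Gamma>)" using z that by simp
      then show ?thesis using \<Gamma>(1) by (simp add: S_def coupling_def del: mem_off_iff)
    qed
    moreover have "snd z \<in> S" if "snd z \<notin> A"
    proof -
      have "snd z \<in># off A (image_mset snd \<Gamma>)" using z that by simp
      then show ?thesis using \<Gamma>(1) by (simp add: S_def coupling_def del: mem_off_iff)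
    qed
    ultimately show "fst z = snd z \<or> (fst z \<in> A \<and> snd z \<in> A)"
      using \<delta>_le[of "fst z" "snd z"] \<delta>_le[of "snd z" "fst z"] near by (force simp: dist_commute)
  qed
  then have "off A (image_mset fst \<Gamma>) = off A (image_mset snd \<Gamma>)"
    by (induction \<Gamma>) (auto simp: off_def)
  then show ?thesis using \<Gamma>(1) by (metis coupling_def)
qed

section \<open>Cubes in the space of diagrams\<close>

definition diagram_of :: "'a set \<Rightarrow> 'a multiset \<Rightarrow> 'a multiset set" where
  "diagram_of A \<sigma> = {\<tau>. off A \<tau> = off A \<sigma>}"

lemma finite_diagrams_eq: "finite_diagrams A = range (diagram_of A)"
proof -
  have "diagram_equiv A `` {\<sigma>} = diagram_of A \<sigma>" for \<sigma>
    by (auto simp: diagram_equiv_iff diagram_of_def)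
  then show ?thesis by (auto simp: finite_diagrams_def quotient_def)
qed

lemma diagram_dist_diagram_of:
  assumes "a \<in> A"
  shows "diagram_dist p A (diagram_of A \<sigma>) (diagram_of A \<tau>) = wasserstein p A \<sigma> \<tau>"
proof -
  have "off A (SOME \<mu>. \<mu> \<in> diagram_of A \<nu>) = off A \<nu>" for \<nu>
    using someI[of "\<lambda>\<mu>. \<mu> \<in> diagram_of A \<nu>" \<nu>] by (simp add: diagram_of_def)
  then show ?thesis unfolding diagram_dist_def by (intro wasserstein_cong_off[OF assms])
qed

theorem Metric_space_finite_diagrams:
  assumes "closed A" "a \<in> A" "1 \<le> p"
  shows "Metric_space (finite_diagrams A) (diagram_dist p A)"
proof
  have "0 < p" using assms(3) by simp
  fix S T R :: "'a multiset set"
  show "0 \<le> diagram_dist p A S T"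
    unfolding diagram_dist_def by (rule wasserstein_nonneg)
  show "diagram_dist p A S T = diagram_dist p A T S"
    unfolding diagram_dist_def using wasserstein_commute_le[OF assms(2) \<open>0 < p\<close>] by (simp add: antisym)
  assume "S \<in> finite_diagrams A" "T \<in> finite_diagrams A"
  then obtain \<sigma> \<tau> where ST: "S = diagram_of A \<sigma>" "T = diagram_of A \<tau>"
    by (auto simp: finite_diagrams_eq)
  show "diagram_dist p A S T = 0 \<longleftrightarrow> S = T"
  proof
    assume "diagram_dist p A S T = 0"
    then have "off A \<sigma> = off A \<tau>"
      using off_eq_of_wasserstein_eq_0[OF assms(1,2) \<open>0 < p\<close>]
      unfolding ST diagram_dist_diagram_of[OF assms(2)] by blast
    then show "S = T" by (simp add: ST diagram_of_def)
  next
    assume "S = T"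
    have "coupling A \<sigma> \<sigma> (image_mset (\<lambda>x. (x, x)) \<sigma>)"
      by (simp add: coupling_def image_mset.compositionality comp_def)
    moreover have "coupling_cost p (image_mset (\<lambda>x. (x, x)) \<sigma>) = 0"
      by (simp add: coupling_cost_def image_mset.compositionality comp_def)
    ultimately have "wasserstein p A \<sigma> \<sigma> \<le> 0"
      using wasserstein_le_coupling[OF assms(2) \<open>0 < p\<close>] by fastforce
    then have "diagram_dist p A S S = 0"
      using wasserstein_nonneg[of p A \<sigma> \<sigma>] by (simp add: ST(1) diagram_dist_diagram_of[OF assms(2)])
    then show "diagram_dist p A S T = 0" using \<open>S = T\<close> by simp
  qed
  assume "R \<in> finite_diagrams A"
  then obtain \<rho> where "R = diagram_of A \<rho>" by (auto simp: finite_diagrams_eq)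
  then show "diagram_dist p A S R \<le> diagram_dist p A S T + diagram_dist p A T R"
    unfolding ST by (simp add: diagram_dist_diagram_of[OF assms(2)] wasserstein_triangle[OF assms(2,3)])
qed

text \<open>
  The curve \<open>P\<close> is a geodesic ray that leaves \<open>A\<close> at least at half its speed. The
  \<open>i\<close>-th point of the diagram for \<open>s\<close> is placed at time \<open>(2 * i + 2) * L + s i\<close>. The slots of
  two such points, intervals of length \<open>L\<close>, are separated by gaps of length \<open>L\<close>, and the initial gap
  \<open>2 * L\<close> keeps all points at distance at least \<open>L\<close> from \<open>A\<close>. So whatever the \<open>i\<close>-th point of one diagram is
  matched with, it has to travel at least \<open>\<bar>s i - s' i\<bar>\<close>; matching points with equal index
  attains the \<open>\<ell>\<^sup>p\<close> distance, which is at most the \<open>\<ell>\<^sup>1\<close> distance.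
\<close>
lemma Metric_space_with_cubes_finite_diagrams:
  fixes P :: "real \<Rightarrow> 'a::metric_space"
  assumes "closed A" "a \<in> A" "1 \<le> p"
    and iso: "\<And>s t. 0 \<le> s \<Longrightarrow> 0 \<le> t \<Longrightarrow> dist (P s) (P t) = \<bar>s - t\<bar>"
    and away: "\<And>t x. 0 \<le> t \<Longrightarrow> x \<in> A \<Longrightarrow> t / 2 \<le> dist (P t) x"
  shows "Metric_space_with_cubes (finite_diagrams A) (diagram_dist p A)"
proof -
  interpret Metric_space "finite_diagrams A" "diagram_dist p A"
    by (rule Metric_space_finite_diagrams[OF assms(1-3)])
  have "0 < p" using assms(3) by simp
  show ?thesis
  proof
    fix N :: nat and L :: real assume "0 < L"
    define t where "t s i = (2 * real i + 2) * L + s i" for s i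
    define \<sigma> where "\<sigma> s = image_mset (\<lambda>i. P (t s i)) (mset_set {..<N})" for s
    have t_bounds: "2 * L \<le> t s i" if "s \<in> cube N L" "i < N" for s i
    proof -
      have "0 \<le> s i" using that by (simp add: cube_def)
      moreover have "0 \<le> real i * L" using \<open>0 < L\<close> by simp
      ultimately show ?thesis by (simp add: t_def algebra_simps)
    qed
    have t_nonneg: "0 \<le> t s i" if "s \<in> cube N L" "i < N" for s i
      using t_bounds[OF that] \<open>0 < L\<close> by simp
    have far_A: "L \<le> dist (P (t s i)) x" if "s \<in> cube N L" "i < N" "x \<in> A" for s i x
      using away[OF t_nonneg that(3), OF that(1,2)] t_bounds[OF that(1,2)] by simp
    have t_diff: "\<bar>s i - s' i\<bar> \<le> \<bar>t s i - t s' j\<bar>"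
      if "s \<in> cube N L" "s' \<in> cube N L" "i < N" "j < N" for s s' i j
    proof (cases "i = j")
      case True
      then show ?thesis by (simp add: t_def)
    next
      case False
      have s: "0 \<le> s i" "s i \<le> L" "0 \<le> s' i" "s' i \<le> L" "0 \<le> s' j" "s' j \<le> L"
        using that by (auto simp: cube_def)
      have "1 \<le> \<bar>real i - real j\<bar>" using False by linarith
      then have "L \<le> \<bar>(real i - real j) * L\<bar>" using \<open>0 < L\<close> by (simp add: abs_mult)
      moreover have "t s i - t s' j = 2 * ((real i - real j) * L) + (s i - s' j)"
        by (simp add: t_def algebra_simps)
      ultimately show ?thesis using s by linarith
    qed
    have "cube_embedding N L (\<lambda>s. diagram_of A (\<sigma> s))"
      unfolding cube_embedding_def diagram_dist_diagram_of[OF assms(2)]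
    proof (intro conjI ballI allI impI)
      show "(\<lambda>s. diagram_of A (\<sigma> s)) ` cube N L \<subseteq> finite_diagrams A"
        by (auto simp: finite_diagrams_eq)
      fix s s' assume s: "s \<in> cube N L" "s' \<in> cube N L"
      show "wasserstein p A (\<sigma> s) (\<sigma> s') \<le> (\<Sum>i<N. \<bar>s i - s' i\<bar>)"
      proof -
        define \<Gamma> where "\<Gamma> = image_mset (\<lambda>i. (P (t s i), P (t s' i))) (mset_set {..<N})"
        have "coupling A (\<sigma> s) (\<sigma> s') \<Gamma>"
          by (simp add: coupling_def \<Gamma>_def \<sigma>_def image_mset.compositionality comp_def)
        then have "wasserstein p A (\<sigma> s) (\<sigma> s') \<le> coupling_cost p \<Gamma> powr (1 / p)"
          by (rule wasserstein_le_coupling[OF assms(2) \<open>0 < p\<close>])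
        also have "coupling_cost p \<Gamma> = (\<Sum>i<N. dist (P (t s i)) (P (t s' i)) powr p)"
          by (simp add: coupling_cost_def \<Gamma>_def image_mset.compositionality comp_def sum_unfold_sum_mset)
        also have "\<dots> = (\<Sum>i<N. \<bar>s i - s' i\<bar> powr p)"
          using t_nonneg s by (intro sum.cong) (simp_all add: iso t_def)
        also have "\<dots> powr (1 / p) \<le> (\<Sum>i<N. \<bar>s i - s' i\<bar>)"
          using assms(3) by (intro powr_sum_le) auto
        finally show ?thesis .
      qed
      fix i assume "i < N"
      show "\<bar>s i - s' i\<bar> \<le> wasserstein p A (\<sigma> s) (\<sigma> s')"
      proof (rule field_le_epsilon)
        fix e :: real assume "0 < e"
        then obtain \<Gamma> where \<Gamma>: "coupling A (\<sigma> s) (\<sigma> s') \<Gamma>"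
          "coupling_cost p \<Gamma> powr (1 / p) < wasserstein p A (\<sigma> s) (\<sigma> s') + e"
          by (rule near_optimal_coupling[OF assms(2) \<open>0 < p\<close>])
        have "P (t s i) \<notin> A"
          using far_A[OF s(1) \<open>i < N\<close>, of "P (t s i)"] \<open>0 < L\<close> by auto
        moreover have "P (t s i) \<in># \<sigma> s" using \<open>i < N\<close> by (auto simp: \<sigma>_def)
        ultimately have "P (t s i) \<in># off A (\<sigma> s)" by simp
        then have "P (t s i) \<in># off A (image_mset fst \<Gamma>)"
          using \<Gamma>(1) by (simp add: coupling_def del: mem_off_iff)
        then obtain z where z: "z \<in># \<Gamma>" "fst z = P (t s i)" by auto
        have "\<bar>s i - s' i\<bar> \<le> dist (fst z) (snd z)"
        proof (cases "snd z \<in> A")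
          case True
          have "\<bar>s i - s' i\<bar> \<le> L" using s \<open>i < N\<close> by (force simp: cube_def abs_le_iff)
          then show ?thesis using far_A[OF s(1) \<open>i < N\<close> True] z(2) by simp
        next
          case False
          then have "snd z \<in># off A (image_mset snd \<Gamma>)" using z(1) by simp
          then have "snd z \<in># off A (\<sigma> s')" using \<Gamma>(1) by (simp add: coupling_def del: mem_off_iff)
          then obtain j where "j < N" "snd z = P (t s' j)" by (auto simp: \<sigma>_def)
          then show ?thesis
            using t_diff[OF s \<open>i < N\<close>, of j] iso t_nonneg s \<open>i < N\<close> z(2) by simp
        qed
        also have "\<dots> \<le> coupling_cost p \<Gamma> powr (1 / p)"
          by (rule dist_le_coupling_cost[OF z(1) \<open>0 < p\<close>])
        finally show "\<bar>s i - s' i\<bar> \<le> wasserstein p A (\<sigma> s) (\<sigma> s') + e"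
          using \<Gamma>(2) by simp
      qed
    qed
    then show "\<exists>f. cube_embedding N L f" by blast
  qed
qed

theorem corollary7p7:
  fixes p :: real
    and \<Delta> :: "((real ^ 'n) \<times> (real ^ 'n)) set"
  assumes "1 \<le> p"
  assumes "\<Delta> = diagonal"
  shows "covering_dimension (Metric_space.mtopology (finite_diagrams \<Delta>) (diagram_dist p \<Delta>)) = \<infinity> \<and>
         Metric_space.hausdorff_dimension (finite_diagrams \<Delta>) (diagram_dist p \<Delta>) = \<infinity> \<and>
         Metric_space.asymptotic_dimension (finite_diagrams \<Delta>) (diagram_dist p \<Delta>) = \<infinity> \<and>
         Metric_space.assouad_dimension (finite_diagrams \<Delta>) (diagram_dist p \<Delta>) = \<infinity> \<and>
         Metric_space.assouad_nagata_dimension (finite_diagrams \<Delta>) (diagram_dist p \<Delta>) = \<infinity>"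
proof -
  \<comment> \<open>The ray \<open>t \<mapsto> (t u, 0)\<close> has distance at least \<open>t / 2\<close> from the diagonal, as \<open>t \<le> dist (t u) v + dist 0 v\<close> for all \<open>v\<close>.\<close>
  define u :: "real ^ 'n" where "u = axis undefined 1"
  have "norm u = 1" by (simp add: u_def)
  define P where "P t = (t *\<^sub>R u, 0 :: real ^ 'n)" for t
  have diagonal_eq: "(diagonal :: ((real ^ 'n) \<times> (real ^ 'n)) set) = {z. fst z = snd z}"
    by (auto simp: diagonal_def)
  interpret Metric_space_with_cubes "finite_diagrams \<Delta>" "diagram_dist p \<Delta>"
  proof (rule Metric_space_with_cubes_finite_diagrams)
    show "closed \<Delta>"
      unfolding assms(2) diagonal_eq by (intro closed_Collect_eq continuous_intros)
    show "(0, 0) \<in> \<Delta>" by (simp add: assms(2) diagonal_eq)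
    show "1 \<le> p" by fact
    show "dist (P s) (P t) = \<bar>s - t\<bar>" for s t
      using \<open>norm u = 1\<close> by (simp add: P_def dist_Pair_Pair dist_norm flip: scaleR_diff_left)
    show "t / 2 \<le> dist (P t) z" if t: "0 \<le> t" and z: "z \<in> \<Delta>" for t z
    proof -
      obtain v where v: "z = (v, v)" using z by (auto simp: assms(2) diagonal_def)
      have "t = dist (t *\<^sub>R u) 0" using t \<open>norm u = 1\<close> by simp
      also have "\<dots> \<le> dist (t *\<^sub>R u) v + dist 0 v" by (rule dist_triangle2)
      also have "\<dots> \<le> dist (P t) z + dist (P t) z"
        using dist_fst_le[of "P t" z] dist_snd_le[of "P t" z] by (intro add_mono) (simp_all add: P_def v)
      finally show ?thesis by simp
    qed
  qed
  show ?thesis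
    using covering_dimension_infinite hausdorff_dimension_infinite asymptotic_dimension_infinite
      assouad_dimension_infinite assouad_nagata_dimension_infinite by blast
qed

end
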